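(* Let $T_n=T_n(X_1,\dots,X_n)$, $n=n_1+n_2$, be a two-sample statistic (symmetric in its first $n_1$ and in its last $n_2$ arguments) such that $T_n = L_n + R_n$, $E(L_n)=0$, with $$L_n=\frac1n\Big[\sum_{i=1}^{n_1}h_1(X_i)+\sum_{i=n_1+1}^{n}h_2(X_i)\Big],\qquad \int h_i^4\,dF_i<\infty,\quad i=1,2,$$ for all sample sizes with $n_i/n\to\lambda_i$, $i=1,2$, as $\min(n_1,n_2)\to\infty$. Assume that the remainder term satisfies $$ n E(R_n^2)=o(1),\qquad n^2E(R_n-R_{n-1})^2=o(1),$$ as $n\to\infty$. Then the following assertions hold. (i) For each $1\le i\le n$: $E(\widehat\xi_i-\xi_i)^2=o(1)$, where $\xi_i=h_1(X_i)$ if $1\le i\le n_1$ and $\xi_i=h_2(X_i)$ if $n_1+1\le i\le n$. (ii) $\widehat\sigma_n^2(T)$ is a consistent and asymptotically unbiased estimator of the asymptotic variance $\sigma^2(T)$ of $T_n$, i.e. $$\left|\frac{\widehat\sigma_n^2(T)}{\sigma^2(T)}-1\right|\to0 \ \text{ in probability},\qquad \left|\frac{E\,\widehat\sigma_n^2(T)}{\sigma^2(T)}-1\right|\to0,$$ as $\min(n_1,n_2)\to\infty$. The associated jackknife variance estimator $\widehat{\mathrm{Var}}(T_n)=\widehat\sigma_n^2(T)/n$ of $\mathrm{Var}(T_n)$ shares these consistency properties, i.e. $\widehat{\mathrm{Var}}(T_n)/\mathrm{Var}(T_n)\to1$ in probability and $E\,\widehat{\mathrm{Var}}(T_n)/\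mathrm{Var}(T_n)\to1$.
   Context: Two independent samples: $X_{ij}\sim F_i$, $j=1,\dots,n_i$, i.i.d. for each $i=1,2$; $n=n_1+n_2$ and $(X_1,\dots,X_n)=(X_{11},\dots,X_{1n_1},X_{21},\dots,X_{2n_2})$. The sample sizes satisfy $n_i/n\to\lambda_i$, $i=1,2$, as $\min(n_1,n_2)\to\infty$. The functions $h_1,h_2$ are fixed (not depending on $n$). The statistic is defined for all sample sizes. Leave-one-out statistics: $T_{n,-i}=T_{n-1}(X_1,\dots,X_{i-1},X_{i+1},\dots,X_n)$ is the statistic computed from the sample with $X_i$ removed (so one of the two sample sizes is reduced by one); it has the decomposition $T_{n,-i}=L_{n,-i}+R_{n,-i}$, where $L_{n,-i}=\frac1{n-1}\sum_{j\ne i}\xi_j$. The symbol $R_{n-1}$ denotes the remainder term when the last observation of one of the samples is omitted; the condition $n^2E(R_n-R_{n-1})^2=o(1)$ is required both when the last observation of the first sample is omitted ($R_{n-1}=R_{n,-n_1}$) and when the last observation of the second sample is omitted ($R_{n-1}=R_{n,-n}$). Leave-one-out pseudo values: $\widehat\xi_i=nT_n-(n-1)T_{n,-i}$, $i=1,\dots,n$. Jackknife estimator of the asymptotic variance: $\widehat\sigma_n^2(T)=\frac{n_1}{n}\widehat\tau_1^2+\frac{n_2}{n}\widehat\tau_2^2$ with $$\widehat\tau_1^2=\frac1{n_1-1}\sum_{j=1}^{n_1}\big(\widehat\xi_j-\overline{\widehat\xi}_{1:n_1}\big)^2,\qquad \widehat\tau_2^2=\frac1{n_2-1}\sum_{j=n_1+1}^{n}\big(\widehat\xi_j-\overline{\widehat\xi}_{(n_1+1):n}\big)^2,$$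 where $\overline{\widehat\xi}_{a:b}=\frac1{b-a+1}\sum_{j=a}^b\widehat\xi_j$. Asymptotic variance of $T_n$: $\sigma^2(T)=\lim_{n\to\infty}\mathrm{Var}(\sqrt n L_n)=\lambda_1\mathrm{Var}(h_1(X_{11}))+\lambda_2\mathrm{Var}(h_2(X_{21}))$, assumed to lie in $(0,\infty)$. *)

theory Defs
  imports "HOL-Probability.Probability" "HOL-Combinatorics.Combinatorics"
begin

text \<open>Observations are numbered from 1, as are the two groups \<open>i \<in> {1, 2}\<close>. They take values in an
  arbitrary measurable space \<open>S\<close>; the case of real observations is \<open>S = borel\<close>.\<close>

locale two_samples = prob_space M
  for M :: "'w measure" and S :: "'a measure" and F :: "nat \<Rightarrow> 'a measure"
    and X :: "nat \<Rightarrow> nat \<Rightarrow> 'w \<Rightarrow> 'a" +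
  assumes observation: "\<And>i j. i \<in> {1, 2} \<Longrightarrow> 1 \<le> j \<Longrightarrow> X i j \<in> measurable M S"
    and distribution: "\<And>i j. i \<in> {1, 2} \<Longrightarrow> 1 \<le> j \<Longrightarrow> distr M S (X i j) = F i"
    and independence: "indep_vars (\<lambda>_. S) (\<lambda>(i, j). X i j) ({1, 2} \<times> {1..})"

definition pooled_sample ::
    "(nat \<Rightarrow> nat \<Rightarrow> 'w \<Rightarrow> 'a) \<Rightarrow> nat \<Rightarrow> nat \<Rightarrow> 'w \<Rightarrow> nat \<Rightarrow> 'a" where
  "pooled_sample X n1 n2 \<omega> = (\<lambda>l\<in>{1..n1 + n2}. if l \<le> n1 then X 1 l \<omega> else X 2 (l - n1) \<omega>)"

text \<open>A statistic is a family \<open>T n1 n2\<close>, one function of \<open>n1 + n2\<close> observations for each pair of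
  sample sizes; its argument is a point of the product space over \<open>{1..n1 + n2}\<close>, with the
  first sample in the first \<open>n1\<close> places.\<close>

definition two_sample_statistic ::
    "'a measure \<Rightarrow> (nat \<Rightarrow> nat \<Rightarrow> (nat \<Rightarrow> 'a) \<Rightarrow> real) \<Rightarrow> bool" where
  "two_sample_statistic S T \<longleftrightarrow>
    (\<forall>n1\<ge>1. \<forall>n2\<ge>1.
      T n1 n2 \<in> borel_measurable (PiM {1..n1 + n2} (\<lambda>_. S)) \<and>
      (\<forall>x\<in>space (PiM {1..n1 + n2} (\<lambda>_. S)). \<forall>p.
        p permutes {1..n1} \<or> p permutes {n1 + 1..n1 + n2} \<longrightarrow> T n1 n2 (x \<circ> p) = T n1 n2 x))"

definition xi :: "(nat \<Rightarrow> 'a \<Rightarrow> real) \<Rightarrow> nat \<Rightarrow> (nat \<Rightarrow> 'a) \<Rightarrow> nat \<Rightarrow> real" where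
  "xi h n1 x i = (if i \<le> n1 then h 1 (x i) else h 2 (x i))"

definition linear_part :: "(nat \<Rightarrow> 'a \<Rightarrow> real) \<Rightarrow> nat \<Rightarrow> nat \<Rightarrow> (nat \<Rightarrow> 'a) \<Rightarrow> real" where
  "linear_part h n1 n2 x =
    1 / real (n1 + n2) * ((\<Sum>i = 1..n1. h 1 (x i)) + (\<Sum>i = n1 + 1..n1 + n2. h 2 (x i)))"

text \<open>The decomposition \<open>T\<^sub>n = L\<^sub>n + R\<^sub>n\<close> determines \<open>R\<^sub>n\<close>, which is therefore defined as the
  difference; likewise for the leave-one-out version.\<close>

definition remainder ::
    "(nat \<Rightarrow> nat \<Rightarrow> (nat \<Rightarrow> 'a) \<Rightarrow> real) \<Rightarrow> (nat \<Rightarrow> 'a \<Rightarrow> real) \<Rightarrow>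
      nat \<Rightarrow> nat \<Rightarrow> (nat \<Rightarrow> 'a) \<Rightarrow> real" where
  "remainder T h n1 n2 x = T n1 n2 x - linear_part h n1 n2 x"

definition omit :: "nat \<Rightarrow> nat \<Rightarrow> (nat \<Rightarrow> 'a) \<Rightarrow> nat \<Rightarrow> 'a" where
  "omit n i x = (\<lambda>l\<in>{1..n - 1}. if l < i then x l else x (l + 1))"

definition leave_one_out ::
    "(nat \<Rightarrow> nat \<Rightarrow> (nat \<Rightarrow> 'a) \<Rightarrow> real) \<Rightarrow> nat \<Rightarrow> nat \<Rightarrow> (nat \<Rightarrow> 'a) \<Rightarrow> nat \<Rightarrow> real" where
  "leave_one_out T n1 n2 x i =
    (if i \<le> n1 then T (n1 - 1) n2 (omit (n1 + n2) i x) else T n1 (n2 - 1) (omit (n1 + n2) i x))"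

definition linear_part_omit ::
    "(nat \<Rightarrow> 'a \<Rightarrow> real) \<Rightarrow> nat \<Rightarrow> nat \<Rightarrow> (nat \<Rightarrow> 'a) \<Rightarrow> nat \<Rightarrow> real" where
  "linear_part_omit h n1 n2 x i =
    1 / (real (n1 + n2) - 1) * (\<Sum>j\<in>{1..n1 + n2} - {i}. xi h n1 x j)"

definition remainder_omit ::
    "(nat \<Rightarrow> nat \<Rightarrow> (nat \<Rightarrow> 'a) \<Rightarrow> real) \<Rightarrow> (nat \<Rightarrow> 'a \<Rightarrow> real) \<Rightarrow>
      nat \<Rightarrow> nat \<Rightarrow> (nat \<Rightarrow> 'a) \<Rightarrow> nat \<Rightarrow> real" where
  "remainder_omit T h n1 n2 x i = leave_one_out T n1 n2 x i - linear_part_omit h n1 n2 x i"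

definition pseudo_value ::
    "(nat \<Rightarrow> nat \<Rightarrow> (nat \<Rightarrow> 'a) \<Rightarrow> real) \<Rightarrow> nat \<Rightarrow> nat \<Rightarrow> (nat \<Rightarrow> 'a) \<Rightarrow> nat \<Rightarrow> real" where
  "pseudo_value T n1 n2 x i =
    real (n1 + n2) * T n1 n2 x - (real (n1 + n2) - 1) * leave_one_out T n1 n2 x i"

definition block_mean :: "nat \<Rightarrow> nat \<Rightarrow> (nat \<Rightarrow> real) \<Rightarrow> real" where
  "block_mean a b y = 1 / (real b - real a + 1) * (\<Sum>j = a..b. y j)"

definition tau1_sq_hat ::
    "(nat \<Rightarrow> nat \<Rightarrow> (nat \<Rightarrow> 'a) \<Rightarrow> real) \<Rightarrow> nat \<Rightarrow> nat \<Rightarrow> (nat \<Rightarrow> 'a) \<Rightarrow> real" where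
  "tau1_sq_hat T n1 n2 x =
    1 / (real n1 - 1) *
      (\<Sum>j = 1..n1. (pseudo_value T n1 n2 x j - block_mean 1 n1 (pseudo_value T n1 n2 x))\<^sup>2)"

definition tau2_sq_hat ::
    "(nat \<Rightarrow> nat \<Rightarrow> (nat \<Rightarrow> 'a) \<Rightarrow> real) \<Rightarrow> nat \<Rightarrow> nat \<Rightarrow> (nat \<Rightarrow> 'a) \<Rightarrow> real" where
  "tau2_sq_hat T n1 n2 x =
    1 / (real n2 - 1) *
      (\<Sum>j = n1 + 1..n1 + n2.
        (pseudo_value T n1 n2 x j - block_mean (n1 + 1) (n1 + n2) (pseudo_value T n1 n2 x))\<^sup>2)"

definition sigma_sq_hat ::
    "(nat \<Rightarrow> nat \<Rightarrow> (nat \<Rightarrow> 'a) \<Rightarrow> real) \<Rightarrow> nat \<Rightarrow> nat \<Rightarrow> (nat \<Rightarrow> 'a) \<Rightarrow> real" where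
  "sigma_sq_hat T n1 n2 x =
    real n1 / real (n1 + n2) * tau1_sq_hat T n1 n2 x +
    real n2 / real (n1 + n2) * tau2_sq_hat T n1 n2 x"

definition var_hat ::
    "(nat \<Rightarrow> nat \<Rightarrow> (nat \<Rightarrow> 'a) \<Rightarrow> real) \<Rightarrow> nat \<Rightarrow> nat \<Rightarrow> (nat \<Rightarrow> 'a) \<Rightarrow> real" where
  "var_hat T n1 n2 x = sigma_sq_hat T n1 n2 x / real (n1 + n2)"

definition asymptotic_variance ::
    "'w measure \<Rightarrow> (nat \<Rightarrow> nat \<Rightarrow> 'w \<Rightarrow> 'a) \<Rightarrow> (nat \<Rightarrow> 'a \<Rightarrow> real) \<Rightarrow> (nat \<Rightarrow> real) \<Rightarrow> real" where
  "asymptotic_variance M X h lam =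
    lam 1 * prob_space.variance M (\<lambda>\<omega>. h 1 (X 1 1 \<omega>)) +
    lam 2 * prob_space.variance M (\<lambda>\<omega>. h 2 (X 2 1 \<omega>))"

text \<open>\<open>E(Y\<^sup>2)\<close> as an element of \<open>[0, \<infinity>]\<close>: a bound or limit for it includes the statement that
  \<open>Y\<close> is square integrable, whereas the Bochner integral of a non-integrable function is 0.\<close>

definition second_moment :: "'w measure \<Rightarrow> ('w \<Rightarrow> real) \<Rightarrow> ennreal" where
  "second_moment M Y = (\<integral>\<^sup>+\<omega>. ennreal ((Y \<omega>)\<^sup>2) \<partial>M)"

definition tendsto_in_probability :: "'w measure \<Rightarrow> (nat \<Rightarrow> 'w \<Rightarrow> real) \<Rightarrow> real \<Rightarrow> bool" where
  "tendsto_in_probability M Y c \<longleftrightarrow>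
    (\<forall>\<^sub>F k in sequentially. Y k \<in> borel_measurable M) \<and>
    (\<forall>\<epsilon>>0. (\<lambda>k. measure M {\<omega> \<in> space M. \<bar>Y k \<omega> - c\<bar> > \<epsilon>}) \<longlonglongrightarrow> 0)"

end

theory Submission
  imports Defs
begin

text \<open>
  Write \<open>n = n\<^sub>1 + n\<^sub>2\<close> and let \<open>D\<^sub>i\<close> be the pseudo value of observation \<open>i\<close> minus its score \<open>\<xi>\<^sub>i\<close>.
  In \<open>n T\<^sub>n - (n - 1) T\<^bsub>n,-i\<^esub>\<close> the linear parts cancel except for \<open>\<xi>\<^sub>i\<close>, so that
  \<open>D\<^sub>i = (n - 1) (R\<^sub>n - R\<^bsub>n,-i\<^esub>) + R\<^sub>n\<close>. The hypotheses control only the omission of the last observation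
  of a sample; since \<open>T\<close> is symmetric and the observations of one sample are i.i.d., the law of
  \<open>R\<^sub>n - R\<^bsub>n,-i\<^esub>\<close>, and with it the second moment, is the same for all \<open>i\<close> of one sample
  (\<open>second_moment_remainder_difference\<close>). Hence
  \<open>E D\<^sub>i\<^sup>2\<close> tends to 0 uniformly in \<open>i\<close> (\<open>score_error_bound\<close>), which is assertion (i).

  For (ii), each \<open>\<tau>\<close>-estimator is the sample variance of \<open>\<xi>\<^sub>j + D\<^sub>j\<close> over one sample. Everything is
  shown in \<open>L\<^sup>1\<close>, which gives consistency and asymptotic unbiasedness at once. The sample
  variance of the \<open>\<xi>\<^sub>j\<close> alone converges in \<open>L\<^sup>1\<close>: the fourth moments make the \<open>\<xi>\<^sub>j\<^sup>2\<close>
  square integrable, so their mean has variance of order \<open>1/n\<^sub>i\<close> (\<open>sample_variance_L1_error\<close>). The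
  perturbation by \<open>D\<close> is absorbed by
  \<open>\<bar>(a + b)\<^sup>2 - a\<^sup>2\<bar> \<le> e a\<^sup>2 + (1 + 1/e) b\<^sup>2\<close> for every \<open>e > 0\<close>, which replaces the Cauchy-Schwarz inequality
  and the triangle inequality for a seminorm (\<open>sample_variance_perturbation_L1\<close>). The same inequality
  shows that \<open>n Var(T\<^sub>n)\<close> and \<open>n Var(L\<^sub>n)\<close> have the same limit \<open>\<sigma>\<^sup>2(T)\<close> (\<open>variance_perturbation\<close>), and
  dividing the \<open>L\<^sup>1\<close> convergent \<open>\<sigma>\<^sup>2\<close>-estimator by either normalisation completes the proof.
\<close>

section \<open>Perturbed squares\<close>

text \<open>The cross term \<open>2 a b\<close> is at most \<open>e a\<^sup>2 + b\<^sup>2 / e\<close> in absolute value, because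
  \<open>(e a \<plusminus> b)\<^sup>2 / e\<close> is nonnegative.\<close>
lemma abs_square_perturbation_le:
  fixes a b e :: real
  assumes "0 < e"
  shows "\<bar>(a + b)\<^sup>2 - a\<^sup>2\<bar> \<le> e * a\<^sup>2 + (1 + 1 / e) * b\<^sup>2"
proof -
  have "0 \<le> (e * a - b)\<^sup>2 / e" "0 \<le> (e * a + b)\<^sup>2 / e"
    using assms by simp_all
  then have "2 * a * b \<le> e * a\<^sup>2 + b\<^sup>2 / e" "- 2 * a * b \<le> e * a\<^sup>2 + b\<^sup>2 / e"
    using assms by (simp_all add: power2_eq_square field_simps)
  moreover have "0 \<le> e * a\<^sup>2" "0 \<le> b\<^sup>2 / e" "0 \<le> b\<^sup>2"
    using assms by simp_all
  moreover have "(a + b)\<^sup>2 - a\<^sup>2 = 2 * a * b + b\<^sup>2"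
    "(1 + 1 / e) * b\<^sup>2 = b\<^sup>2 + b\<^sup>2 / e"
    by (simp_all add: power2_eq_square algebra_simps)
  ultimately show ?thesis
    by (simp only:)
qed

text \<open>The inequality above is applied to means, with \<open>A\<close> the main term and \<open>b\<close> the negligible one;
  since \<open>A\<close> stays bounded, a small \<open>e\<close> fixed in advance controls the first summand and the limit
  of \<open>b\<close> the second.\<close>
lemma tendsto_zero_of_perturbation_bound:
  fixes A b c :: "nat \<Rightarrow> real"
  assumes bound: "\<And>e. 0 < e \<Longrightarrow> \<forall>\<^sub>F k in sequentially. \<bar>c k\<bar> \<le> e * A k + (1 + 1 / e) * b k"
    and A: "A \<longlonglongrightarrow> a" and b: "b \<longlonglongrightarrow> 0"
  shows "c \<longlonglongrightarrow> 0"
proof (rule tendstoI)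
  fix r :: real
  assume r: "0 < r"
  \<comment> \<open>Then \<open>e * a\<close> is at most \<open>r / 2\<close>; the summand 1 is there for \<open>a = 0\<close>.\<close>
  define e where "e = r / (2 * (\<bar>a\<bar> + 1))"
  have e: "0 < e"
    using r by (simp add: e_def)
  have "(\<lambda>k. e * A k + (1 + 1 / e) * b k) \<longlonglongrightarrow> e * a + (1 + 1 / e) * 0"
    by (intro tendsto_intros A b)
  moreover have "e * a + (1 + 1 / e) * 0 < r"
  proof -
    have "e * a \<le> e * (\<bar>a\<bar> + 1)"
      using e by (intro mult_left_mono) auto
    also have "\<dots> = r / 2"
      using r by (simp add: e_def field_simps)
    finally show ?thesis
      using r by simp
  qed
  ultimately have "\<forall>\<^sub>F k in sequentially. e * A k + (1 + 1 / e) * b k < r"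
    by (rule order_tendstoD)
  with bound[OF e] show "\<forall>\<^sub>F k in sequentially. dist (c k) 0 < r"
    by eventually_elim simp
qed

section \<open>Orthogonality and convergence in mean\<close>

context prob_space
begin

lemma integrable_product_of_squares:
  fixes Y Z :: "'a \<Rightarrow> real"
  assumes [measurable]: "Y \<in> borel_measurable M" "Z \<in> borel_measurable M"
    and "integrable M (\<lambda>\<omega>. (Y \<omega>)\<^sup>2)" "integrable M (\<lambda>\<omega>. (Z \<omega>)\<^sup>2)"
  shows "integrable M (\<lambda>\<omega>. Y \<omega> * Z \<omega>)"
proof (rule Bochner_Integration.integrable_bound)
  show "integrable M (\<lambda>\<omega>. (Y \<omega>)\<^sup>2 + (Z \<omega>)\<^sup>2)"
    using assms by simp
  have "\<bar>y * z\<bar> \<le> y\<^sup>2 + z\<^sup>2" for y z :: real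
  proof -
    have "2 * \<bar>y * z\<bar> \<le> y\<^sup>2 + z\<^sup>2"
      using sum_squares_bound[of "\<bar>y\<bar>" "\<bar>z\<bar>"] by (simp add: abs_mult)
    then show ?thesis
      using abs_ge_zero[of "y * z"] by linarith
  qed
  then show "AE \<omega> in M. norm (Y \<omega> * Z \<omega>) \<le> norm ((Y \<omega>)\<^sup>2 + (Z \<omega>)\<^sup>2)"
    by simp
qed simp

lemma integrable_square_add:
  fixes Y Z :: "'a \<Rightarrow> real"
  assumes "Y \<in> borel_measurable M" "Z \<in> borel_measurable M"
    and "integrable M (\<lambda>\<omega>. (Y \<omega>)\<^sup>2)" "integrable M (\<lambda>\<omega>. (Z \<omega>)\<^sup>2)"
  shows "integrable M (\<lambda>\<omega>. (Y \<omega> + Z \<omega>)\<^sup>2)"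
  using integrable_product_of_squares[OF assms] assms(3,4)
  by (simp add: power2_sum mult.assoc)

lemma integrable_square_sum:
  fixes Y :: "'i \<Rightarrow> 'a \<Rightarrow> real"
  assumes "\<And>i. i \<in> I \<Longrightarrow> Y i \<in> borel_measurable M"
    and "\<And>i. i \<in> I \<Longrightarrow> integrable M (\<lambda>\<omega>. (Y i \<omega>)\<^sup>2)"
  shows "integrable M (\<lambda>\<omega>. (\<Sum>i\<in>I. Y i \<omega>)\<^sup>2)"
  using assms integrable_product_of_squares
  by (simp add: power2_eq_square sum_product)

text \<open>This one identity yields the variance of the linear part, the mean square of a sample mean, and
  the \<open>L\<^sup>2\<close> law of large numbers for the squared scores.\<close>
lemma expectation_square_sum_orthogonal:
  fixes Y :: "'i \<Rightarrow> 'a \<Rightarrow> real"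
  assumes fin: "finite I"
    and meas: "\<And>i. i \<in> I \<Longrightarrow> Y i \<in> borel_measurable M"
    and int: "\<And>i. i \<in> I \<Longrightarrow> integrable M (\<lambda>\<omega>. (Y i \<omega>)\<^sup>2)"
    and orth: "\<And>i j. i \<in> I \<Longrightarrow> j \<in> I \<Longrightarrow> i \<noteq> j \<Longrightarrow> expectation (\<lambda>\<omega>. Y i \<omega> * Y j \<omega>) = 0"
  shows "expectation (\<lambda>\<omega>. (\<Sum>i\<in>I. Y i \<omega>)\<^sup>2) = (\<Sum>i\<in>I. expectation (\<lambda>\<omega>. (Y i \<omega>)\<^sup>2))"
proof -
  have prod: "integrable M (\<lambda>\<omega>. Y i \<omega> * Y j \<omega>)" if "i \<in> I" "j \<in> I" for i j
    using that meas int by (intro integrable_product_of_squares)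
  have "expectation (\<lambda>\<omega>. (\<Sum>i\<in>I. Y i \<omega>)\<^sup>2) = (\<Sum>i\<in>I. \<Sum>j\<in>I. expectation (\<lambda>\<omega>. Y i \<omega> * Y j \<omega>))"
    by (simp add: power2_eq_square sum_product prod Bochner_Integration.integral_sum
        Bochner_Integration.integrable_sum)
  also have "\<dots> = (\<Sum>i\<in>I. \<Sum>j\<in>I. if i = j then expectation (\<lambda>\<omega>. (Y i \<omega>)\<^sup>2) else 0)"
    using orth by (intro sum.cong refl) (auto simp: power2_eq_square)
  finally show ?thesis
    using fin by simp
qed

lemma expectation_abs_le_sqrt:
  fixes Y :: "'a \<Rightarrow> real"
  assumes "Y \<in> borel_measurable M" "integrable M (\<lambda>\<omega>. (Y \<omega>)\<^sup>2)"
  shows "expectation (\<lambda>\<omega>. \<bar>Y \<omega>\<bar>) \<le> sqrt (expectation (\<lambda>\<omega>. (Y \<omega>)\<^sup>2))"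
proof (rule real_le_rsqrt)
  have "integrable M (\<lambda>\<omega>. \<bar>Y \<omega>\<bar>)"
    using square_integrable_imp_integrable[OF assms] by simp
  then have "variance (\<lambda>\<omega>. \<bar>Y \<omega>\<bar>) = expectation (\<lambda>\<omega>. (Y \<omega>)\<^sup>2) - (expectation (\<lambda>\<omega>. \<bar>Y \<omega>\<bar>))\<^sup>2"
    using assms by (subst variance_eq) auto
  then show "(expectation (\<lambda>\<omega>. \<bar>Y \<omega>\<bar>))\<^sup>2 \<le> expectation (\<lambda>\<omega>. (Y \<omega>)\<^sup>2)"
    using variance_positive[of "\<lambda>\<omega>. \<bar>Y \<omega>\<bar>"] by linarith
qed

lemma tendsto_in_probability_if_L1:
  fixes Y :: "nat \<Rightarrow> 'a \<Rightarrow> real"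
  assumes int: "\<forall>\<^sub>F k in sequentially. integrable M (Y k)"
    and lim: "(\<lambda>k. expectation (\<lambda>\<omega>. \<bar>Y k \<omega> - c\<bar>)) \<longlonglongrightarrow> 0"
  shows "tendsto_in_probability M Y c"
  unfolding tendsto_in_probability_def
proof (intro conjI allI impI)
  show "\<forall>\<^sub>F k in sequentially. Y k \<in> borel_measurable M"
    using int by eventually_elim auto
  fix e :: real
  assume e: "0 < e"
  show "(\<lambda>k. measure M {\<omega> \<in> space M. e < \<bar>Y k \<omega> - c\<bar>}) \<longlonglongrightarrow> 0"
  proof (rule tendsto_sandwich[OF _ _ tendsto_const])
    show "(\<lambda>k. expectation (\<lambda>\<omega>. \<bar>Y k \<omega> - c\<bar>) / e) \<longlonglongrightarrow> 0"
      using tendsto_divide[OF lim tendsto_const[of e]] e by simp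
    show "\<forall>\<^sub>F k in sequentially. measure M {\<omega> \<in> space M. e < \<bar>Y k \<omega> - c\<bar>}
        \<le> expectation (\<lambda>\<omega>. \<bar>Y k \<omega> - c\<bar>) / e"
      using int
    proof eventually_elim
      case (elim k)
      then have [measurable]: "Y k \<in> borel_measurable M"
        by auto
      have "measure M {\<omega> \<in> space M. e < \<bar>Y k \<omega> - c\<bar>} \<le> measure M {\<omega> \<in> space M. e \<le> \<bar>Y k \<omega> - c\<bar>}"
        by (intro finite_measure_mono) auto
      also have "\<dots> \<le> expectation (\<lambda>\<omega>. \<bar>Y k \<omega> - c\<bar>) / e"
        using elim e by (intro integral_Markov_inequality_measure[where A = "space M"]) auto
      finally show ?case .
    qed
  qed simp
qed

lemma second_moment_eq_expectation:
  assumes "integrable M (\<lambda>\<omega>. (Y \<omega>)\<^sup>2)"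
  shows "second_moment M Y = ennreal (expectation (\<lambda>\<omega>. (Y \<omega>)\<^sup>2))"
  unfolding second_moment_def using assms by (intro nn_integral_eq_integral) auto

lemma square_integrable_if_second_moment_finite:
  assumes "Y \<in> borel_measurable M" "second_moment M Y < \<infinity>"
  shows "integrable M (\<lambda>\<omega>. (Y \<omega>)\<^sup>2)"
  using assms unfolding second_moment_def by (intro integrableI_nonneg) auto

text \<open>The hypotheses on the remainders are limits in \<open>[0, \<infinity>]\<close>. From the index on where the scaled
  moment is below 1 the variables are square integrable, and the limit is one of real numbers.\<close>
lemma scaled_second_moment_tendsto_zeroD:
  fixes Y :: "nat \<Rightarrow> 'a \<Rightarrow> real" and c :: "nat \<Rightarrow> nat"
  assumes lim: "(\<lambda>k. of_nat (c k) * second_moment M (Y k)) \<longlonglongrightarrow> 0"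
    and meas: "\<forall>\<^sub>F k in sequentially. Y k \<in> borel_measurable M"
    and pos: "\<forall>\<^sub>F k in sequentially. 1 \<le> c k"
  shows "\<forall>\<^sub>F k in sequentially. integrable M (\<lambda>\<omega>. (Y k \<omega>)\<^sup>2)"
    and "(\<lambda>k. real (c k) * expectation (\<lambda>\<omega>. (Y k \<omega>)\<^sup>2)) \<longlonglongrightarrow> 0"
proof -
  have "\<forall>\<^sub>F k in sequentially. of_nat (c k) * second_moment M (Y k) < 1"
    using lim by (rule order_tendstoD) simp
  with meas pos show int: "\<forall>\<^sub>F k in sequentially. integrable M (\<lambda>\<omega>. (Y k \<omega>)\<^sup>2)"
  proof eventually_elim
    case (elim k)
    have "second_moment M (Y k) \<le> of_nat (c k) * second_moment M (Y k)"
      using mult_right_mono[of "1::ennreal" "of_nat (c k)" "second_moment M (Y k)"] elim(2)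
      by (simp add: ennreal_of_nat_eq_real_of_nat)
    also have "\<dots> < \<infinity>"
      using elim(3) by (rule order.strict_trans) simp
    finally show ?case
      using elim(1) by (intro square_integrable_if_second_moment_finite)
  qed
  have "\<forall>\<^sub>F k in sequentially. of_nat (c k) * second_moment M (Y k)
      = ennreal (real (c k) * expectation (\<lambda>\<omega>. (Y k \<omega>)\<^sup>2))"
    using int
    by eventually_elim
      (simp add: second_moment_eq_expectation ennreal_of_nat_eq_real_of_nat ennreal_mult')
  then have "(\<lambda>k. ennreal (real (c k) * expectation (\<lambda>\<omega>. (Y k \<omega>)\<^sup>2))) \<longlonglongrightarrow> ennreal 0"
    using lim by (simp add: tendsto_cong)
  then show "(\<lambda>k. real (c k) * expectation (\<lambda>\<omega>. (Y k \<omega>)\<^sup>2)) \<longlonglongrightarrow> 0"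
    by (rule tendsto_ennrealD) auto
qed

text \<open>Centring \<open>R\<close> only decreases its second moment, so the perturbation inequality applies to \<open>L\<close>
  and the centred \<open>R\<close>.\<close>
lemma variance_perturbation:
  fixes L R :: "'a \<Rightarrow> real"
  assumes L: "L \<in> borel_measurable M" "integrable M (\<lambda>\<omega>. (L \<omega>)\<^sup>2)" "expectation L = 0"
    and R: "R \<in> borel_measurable M" "integrable M (\<lambda>\<omega>. (R \<omega>)\<^sup>2)"
    and e: "0 < e"
  shows "\<bar>variance (\<lambda>\<omega>. L \<omega> + R \<omega>) - expectation (\<lambda>\<omega>. (L \<omega>)\<^sup>2)\<bar>
    \<le> e * expectation (\<lambda>\<omega>. (L \<omega>)\<^sup>2) + (1 + 1 / e) * expectation (\<lambda>\<omega>. (R \<omega>)\<^sup>2)"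
proof -
  note L1 = square_integrable_imp_integrable[OF L(1,2)]
  note R1 = square_integrable_imp_integrable[OF R]
  define Q where "Q \<omega> = R \<omega> - expectation R" for \<omega>
  have Q_meas: "Q \<in> borel_measurable M"
    unfolding Q_def[abs_def] using R(1) by simp
  have Q_int: "integrable M (\<lambda>\<omega>. (Q \<omega>)\<^sup>2)"
    unfolding Q_def power2_diff using R R1 by simp
  have LQ_int: "integrable M (\<lambda>\<omega>. (L \<omega> + Q \<omega>)\<^sup>2)"
    using L Q_meas Q_int by (intro integrable_square_add)
  have "variance (\<lambda>\<omega>. L \<omega> + R \<omega>) = expectation (\<lambda>\<omega>. (L \<omega> + Q \<omega>)\<^sup>2)"
    using L1 R1 L(3) by (simp add: Q_def algebra_simps)
  then have "\<bar>variance (\<lambda>\<omega>. L \<omega> + R \<omega>) - expectation (\<lambda>\<omega>. (L \<omega>)\<^sup>2)\<bar>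
      = \<bar>expectation (\<lambda>\<omega>. (L \<omega> + Q \<omega>)\<^sup>2 - (L \<omega>)\<^sup>2)\<bar>"
    using LQ_int L(2) by simp
  also have "\<dots> \<le> expectation (\<lambda>\<omega>. \<bar>(L \<omega> + Q \<omega>)\<^sup>2 - (L \<omega>)\<^sup>2\<bar>)"
    by (rule integral_abs_bound)
  also have "\<dots> \<le> expectation (\<lambda>\<omega>. e * (L \<omega>)\<^sup>2 + (1 + 1 / e) * (Q \<omega>)\<^sup>2)"
    using LQ_int L(2) Q_int e by (intro integral_mono abs_square_perturbation_le) auto
  also have "\<dots> = e * expectation (\<lambda>\<omega>. (L \<omega>)\<^sup>2) + (1 + 1 / e) * expectation (\<lambda>\<omega>. (Q \<omega>)\<^sup>2)"
    using L(2) Q_int by simp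
  also have "\<dots> \<le> e * expectation (\<lambda>\<omega>. (L \<omega>)\<^sup>2) + (1 + 1 / e) * expectation (\<lambda>\<omega>. (R \<omega>)\<^sup>2)"
    using e variance_eq[OF R1 R(2)] by (intro add_left_mono mult_left_mono) (auto simp: Q_def)
  finally show ?thesis .
qed

text \<open>With \<open>w\<close> constant this normalises by the asymptotic variance, and with \<open>w = n Var(T\<^sub>n)\<close> by the
  variance of the statistic itself.\<close>
lemma ratio_L1_tendsto:
  fixes Y :: "nat \<Rightarrow> 'a \<Rightarrow> real" and w :: "nat \<Rightarrow> real"
  assumes int: "\<forall>\<^sub>F k in sequentially. integrable M (Y k)"
    and lim: "(\<lambda>k. expectation (\<lambda>\<omega>. \<bar>Y k \<omega> - a\<bar>)) \<longlonglongrightarrow> 0"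
    and w: "w \<longlonglongrightarrow> a" and a: "0 < a"
  shows "(\<lambda>k. expectation (\<lambda>\<omega>. \<bar>Y k \<omega> / w k - 1\<bar>)) \<longlonglongrightarrow> 0"
proof (rule tendsto_sandwich[OF _ _ tendsto_const])
  have "(\<lambda>k. (expectation (\<lambda>\<omega>. \<bar>Y k \<omega> - a\<bar>) + \<bar>a - w k\<bar>) / w k) \<longlonglongrightarrow> (0 + \<bar>a - a\<bar>) / a"
    using a by (intro tendsto_intros lim w) auto
  then show "(\<lambda>k. (expectation (\<lambda>\<omega>. \<bar>Y k \<omega> - a\<bar>) + \<bar>a - w k\<bar>) / w k) \<longlonglongrightarrow> 0"
    by simp
  have "\<forall>\<^sub>F k in sequentially. 0 < w k"
    using w a by (rule order_tendstoD)
  with int show "\<forall>\<^sub>F k in sequentially. expectation (\<lambda>\<omega>. \<bar>Y k \<omega> / w k - 1\<bar>)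
      \<le> (expectation (\<lambda>\<omega>. \<bar>Y k \<omega> - a\<bar>) + \<bar>a - w k\<bar>) / w k"
  proof eventually_elim
    case (elim k)
    have "expectation (\<lambda>\<omega>. \<bar>Y k \<omega> / w k - 1\<bar>) \<le> expectation (\<lambda>\<omega>. (\<bar>Y k \<omega> - a\<bar> + \<bar>a - w k\<bar>) / w k)"
    proof (rule integral_mono)
      fix \<omega>
      have "\<bar>Y k \<omega> / w k - 1\<bar> = \<bar>Y k \<omega> - w k\<bar> / w k"
      proof -
        have "Y k \<omega> / w k - 1 = (Y k \<omega> - w k) / w k"
          using elim(2) by (simp add: diff_divide_distrib)
        then show ?thesis
          using elim(2) by (simp add: abs_divide)
      qed
      also have "\<dots> \<le> (\<bar>Y k \<omega> - a\<bar> + \<bar>a - w k\<bar>) / w k"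
        using elim(2) by (intro divide_right_mono) auto
      finally show "\<bar>Y k \<omega> / w k - 1\<bar> \<le> (\<bar>Y k \<omega> - a\<bar> + \<bar>a - w k\<bar>) / w k" .
    qed (use elim(1) in auto)
    also have "\<dots> = (expectation (\<lambda>\<omega>. \<bar>Y k \<omega> - a\<bar>) + \<bar>a - w k\<bar>) / w k"
      using elim(1) by (simp add: prob_space)
    finally show ?case .
  qed
qed simp

lemma expectation_tendsto_if_L1:
  fixes Y :: "nat \<Rightarrow> 'a \<Rightarrow> real"
  assumes int: "\<forall>\<^sub>F k in sequentially. integrable M (Y k)"
    and lim: "(\<lambda>k. expectation (\<lambda>\<omega>. \<bar>Y k \<omega> - c\<bar>)) \<longlonglongrightarrow> 0"
  shows "(\<lambda>k. expectation (Y k)) \<longlonglongrightarrow> c"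
proof (rule LIM_zero_cancel, rule Lim_null_comparison[OF _ lim])
  show "\<forall>\<^sub>F k in sequentially. norm (expectation (Y k) - c) \<le> expectation (\<lambda>\<omega>. \<bar>Y k \<omega> - c\<bar>)"
    using int
  proof eventually_elim
    case (elim k)
    have "expectation (Y k) - c = expectation (\<lambda>\<omega>. Y k \<omega> - c)"
      using elim by (simp add: prob_space)
    then show ?case
      using integral_abs_bound[of M "\<lambda>\<omega>. Y k \<omega> - c"] by simp
  qed
qed

end

section \<open>The sample variance\<close>

definition sample_variance :: "'i set \<Rightarrow> ('i \<Rightarrow> real) \<Rightarrow> real" where
  "sample_variance J y =
    (\<Sum>j\<in>J. (y j - (\<Sum>i\<in>J. y i) / real (card J))\<^sup>2) / (real (card J) - 1)"

lemma sum_squared_deviations: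
  assumes "finite J" "J \<noteq> {}"
  shows "(\<Sum>j\<in>J. (y j - (\<Sum>i\<in>J. y i) / real (card J))\<^sup>2)
    = (\<Sum>j\<in>J. (y j)\<^sup>2) - real (card J) * ((\<Sum>i\<in>J. y i) / real (card J))\<^sup>2"
proof -
  define \<mu> where "\<mu> = (\<Sum>i\<in>J. y i) / real (card J)"
  have m: "(\<Sum>i\<in>J. y i) = real (card J) * \<mu>"
    using assms by (simp add: \<mu>_def)
  have "(\<Sum>j\<in>J. (y j - \<mu>)\<^sup>2) = (\<Sum>j\<in>J. (y j)\<^sup>2) - 2 * \<mu> * (\<Sum>j\<in>J. y j) + real (card J) * \<mu>\<^sup>2"
    by (simp add: power2_diff sum.distrib sum_subtractf sum_distrib_left sum_distrib_right mult_ac)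
  also have "\<dots> = (\<Sum>j\<in>J. (y j)\<^sup>2) - real (card J) * \<mu>\<^sup>2"
    unfolding m by (simp add: power2_eq_square)
  finally show ?thesis
    unfolding \<mu>_def .
qed

lemma sample_variance_le:
  assumes "2 \<le> card J"
  shows "sample_variance J y \<le> (\<Sum>j\<in>J. (y j)\<^sup>2) / (real (card J) - 1)"
proof -
  have "finite J" "J \<noteq> {}"
    using assms by (auto intro: card_ge_0_finite)
  from sum_squared_deviations[OF this, of y] show ?thesis
    unfolding sample_variance_def using assms by (intro divide_right_mono) auto
qed

text \<open>The vector of deviations from the mean is linear in the data, hence the inequality for
  squares can be summed over the deviations of \<open>u\<close> and of \<open>d\<close>.\<close>
lemma sample_variance_perturbation:
  assumes m: "2 \<le> card J" and e: "0 < e"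
  shows "\<bar>sample_variance J (\<lambda>j. u j + d j) - sample_variance J u\<bar>
    \<le> e * sample_variance J u + (1 + 1 / e) * sample_variance J d"
proof -
  define a where "a j = u j - (\<Sum>i\<in>J. u i) / real (card J)" for j
  define b where "b j = d j - (\<Sum>i\<in>J. d i) / real (card J)" for j
  have ab: "u j + d j - (\<Sum>i\<in>J. u i + d i) / real (card J) = a j + b j" for j
    by (simp add: a_def b_def sum.distrib add_divide_distrib)
  have "\<bar>(\<Sum>j\<in>J. (a j + b j)\<^sup>2) - (\<Sum>j\<in>J. (a j)\<^sup>2)\<bar> \<le> (\<Sum>j\<in>J. \<bar>(a j + b j)\<^sup>2 - (a j)\<^sup>2\<bar>)"
    by (simp flip: sum_subtractf)
  also have "\<dots> \<le> (\<Sum>j\<in>J. e * (a j)\<^sup>2 + (1 + 1 / e) * (b j)\<^sup>2)"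
    using e by (intro sum_mono abs_square_perturbation_le)
  also have "\<dots> = e * (\<Sum>j\<in>J. (a j)\<^sup>2) + (1 + 1 / e) * (\<Sum>j\<in>J. (b j)\<^sup>2)"
    by (simp only: sum.distrib sum_distrib_left)
  finally have "\<bar>(\<Sum>j\<in>J. (a j + b j)\<^sup>2) - (\<Sum>j\<in>J. (a j)\<^sup>2)\<bar> / (real (card J) - 1)
      \<le> (e * (\<Sum>j\<in>J. (a j)\<^sup>2) + (1 + 1 / e) * (\<Sum>j\<in>J. (b j)\<^sup>2)) / (real (card J) - 1)"
    using m by (intro divide_right_mono) auto
  then show ?thesis
    using m
    unfolding sample_variance_def ab a_def[symmetric] b_def[symmetric]
    by (simp add: add_divide_distrib flip: diff_divide_distrib)
qed

text \<open>The constant 2 bounds \<open>m / (m - 1)\<close> for a sample size \<open>m \<ge> 2\<close>. The \<open>Y j\<close> may be dependent, as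
  the errors of the pseudo values are.\<close>
lemma (in prob_space) expectation_sample_variance_le:
  assumes m: "2 \<le> card J"
    and meas: "\<And>j. j \<in> J \<Longrightarrow> Y j \<in> borel_measurable M"
    and int: "\<And>j. j \<in> J \<Longrightarrow> integrable M (\<lambda>\<omega>. (Y j \<omega>)\<^sup>2)"
    and bound: "\<And>j. j \<in> J \<Longrightarrow> expectation (\<lambda>\<omega>. (Y j \<omega>)\<^sup>2) \<le> s"
  shows "integrable M (\<lambda>\<omega>. sample_variance J (\<lambda>j. Y j \<omega>))"
    and "expectation (\<lambda>\<omega>. sample_variance J (\<lambda>j. Y j \<omega>)) \<le> 2 * s"
proof -
  have J: "finite J" "J \<noteq> {}"
    using m by (auto intro: card_ge_0_finite)
  show i: "integrable M (\<lambda>\<omega>. sample_variance J (\<lambda>j. Y j \<omega>))"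
    unfolding sample_variance_def sum_squared_deviations[OF J] power_divide
    using int integrable_square_sum[of J Y, OF meas int] by simp
  obtain j where "j \<in> J"
    using J by auto
  have "0 \<le> expectation (\<lambda>\<omega>. (Y j \<omega>)\<^sup>2)"
    by simp
  with bound[OF \<open>j \<in> J\<close>] have s: "0 \<le> s"
    by linarith
  have "expectation (\<lambda>\<omega>. sample_variance J (\<lambda>j. Y j \<omega>))
      \<le> expectation (\<lambda>\<omega>. (\<Sum>j\<in>J. (Y j \<omega>)\<^sup>2) / (real (card J) - 1))"
    using m int i by (intro integral_mono sample_variance_le) auto
  also have "\<dots> = (\<Sum>j\<in>J. expectation (\<lambda>\<omega>. (Y j \<omega>)\<^sup>2)) / (real (card J) - 1)"
    using int by (simp add: Bochner_Integration.integral_sum)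
  also have "\<dots> \<le> (\<Sum>j\<in>J. s) / (real (card J) - 1)"
    using m bound by (intro divide_right_mono sum_mono) auto
  also have "\<dots> \<le> 2 * s"
  proof -
    have "real (card J) * s \<le> (2 * (real (card J) - 1)) * s"
      using m s by (intro mult_right_mono) auto
    then show ?thesis
      using m by (simp add: field_simps)
  qed
  finally show "expectation (\<lambda>\<omega>. sample_variance J (\<lambda>j. Y j \<omega>)) \<le> 2 * s" .
qed

text \<open>Up to the factor \<open>m / (m - 1)\<close>, the sample variance is the mean of the squares minus the square
  of the mean. By orthogonality, the former deviates from \<open>v\<close> by \<open>sqrt (c / m)\<close> in \<open>L\<^sup>2\<close>, and the
  latter has expectation \<open>v / m\<close>.\<close>
lemma (in prob_space) sample_variance_L1_error:
  fixes U :: "'i \<Rightarrow> 'a \<Rightarrow> real"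
  assumes m: "2 \<le> card J"
    and meas: "\<And>j. j \<in> J \<Longrightarrow> U j \<in> borel_measurable M"
    and int2: "\<And>j. j \<in> J \<Longrightarrow> integrable M (\<lambda>\<omega>. (U j \<omega>)\<^sup>2)"
    and int4: "\<And>j. j \<in> J \<Longrightarrow> integrable M (\<lambda>\<omega>. ((U j \<omega>)\<^sup>2 - v)\<^sup>2)"
    and v: "\<And>j. j \<in> J \<Longrightarrow> expectation (\<lambda>\<omega>. (U j \<omega>)\<^sup>2) = v"
    and c: "\<And>j. j \<in> J \<Longrightarrow> expectation (\<lambda>\<omega>. ((U j \<omega>)\<^sup>2 - v)\<^sup>2) = c"
    and orth: "\<And>i j. i \<in> J \<Longrightarrow> j \<in> J \<Longrightarrow> i \<noteq> j \<Longrightarrow> expectation (\<lambda>\<omega>. U i \<omega> * U j \<omega>) = 0"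
    and orth_squares: "\<And>i j. i \<in> J \<Longrightarrow> j \<in> J \<Longrightarrow> i \<noteq> j \<Longrightarrow>
      expectation (\<lambda>\<omega>. ((U i \<omega>)\<^sup>2 - v) * ((U j \<omega>)\<^sup>2 - v)) = 0"
  shows "expectation (\<lambda>\<omega>. \<bar>sample_variance J (\<lambda>j. U j \<omega>) - v\<bar>)
    \<le> 2 * sqrt (c / card J) + 4 * v / card J"
proof -
  define m where "m = real (card J)"
  have m2: "2 \<le> m"
    using m by (simp add: m_def)
  have J: "finite J" "J \<noteq> {}"
    using m by (auto intro: card_ge_0_finite)
  obtain j0 where j0: "j0 \<in> J"
    using J by auto
  have v0: "0 \<le> v"
    using v[OF j0] by (metis Bochner_Integration.integral_nonneg zero_le_power2)
  define A where "A \<omega> = (\<Sum>j\<in>J. (U j \<omega>)\<^sup>2 - v) / m" for \<omega>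
  define B where "B \<omega> = (\<Sum>j\<in>J. U j \<omega>) / m" for \<omega>
  have U2meas: "(\<lambda>\<omega>. (U j \<omega>)\<^sup>2 - v) \<in> borel_measurable M" if "j \<in> J" for j
    using meas[OF that] by measurable
  have A_meas: "A \<in> borel_measurable M"
    unfolding A_def using U2meas by (intro borel_measurable_divide borel_measurable_sum) auto
  have A2: "expectation (\<lambda>\<omega>. (A \<omega>)\<^sup>2) = c / m"
    unfolding A_def power_divide
    using m2 c by (simp add: expectation_square_sum_orthogonal[OF J(1) U2meas int4 orth_squares])
      (simp add: power2_eq_square m_def)
  have A_int: "integrable M (\<lambda>\<omega>. (A \<omega>)\<^sup>2)"
    unfolding A_def power_divide using integrable_square_sum[of J "\<lambda>j \<omega>. (U j \<omega>)\<^sup>2 - v", OF U2meas int4] by simp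
  have B2: "expectation (\<lambda>\<omega>. (B \<omega>)\<^sup>2) = v / m"
    unfolding B_def power_divide
    using m2 v by (simp add: expectation_square_sum_orthogonal[OF J(1) meas int2 orth])
      (simp add: power2_eq_square m_def)
  have B_int: "integrable M (\<lambda>\<omega>. (B \<omega>)\<^sup>2)"
    unfolding B_def power_divide using integrable_square_sum[of J U, OF meas int2] by simp
  have A_abs: "integrable M (\<lambda>\<omega>. \<bar>A \<omega>\<bar>)"
    using square_integrable_imp_integrable[OF A_meas A_int] by simp
  have pointwise: "\<bar>sample_variance J (\<lambda>j. U j \<omega>) - v\<bar> \<le> 2 * \<bar>A \<omega>\<bar> + 2 * (B \<omega>)\<^sup>2 + 2 * v / m" for \<omega>
  proof -
    have q: "0 \<le> m / (m - 1)" "m / (m - 1) \<le> 2" "0 \<le> 1 / (m - 1)" "1 / (m - 1) \<le> 2 / m"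
      using m2 by (simp_all add: field_simps)
    have "(\<Sum>j\<in>J. (U j \<omega>)\<^sup>2) = m * A \<omega> + m * v"
      using m2 by (simp add: A_def sum_subtractf m_def)
    then have "sample_variance J (\<lambda>j. U j \<omega>) = (m * A \<omega> + m * v - m * (B \<omega>)\<^sup>2) / (m - 1)"
      unfolding sample_variance_def sum_squared_deviations[OF J] B_def m_def by simp
    also have "\<dots> - v = m / (m - 1) * A \<omega> - m / (m - 1) * (B \<omega>)\<^sup>2 + 1 / (m - 1) * v"
      using m2 by (simp add: divide_simps) (simp add: algebra_simps)
    also have "\<bar>\<dots>\<bar> \<le> m / (m - 1) * \<bar>A \<omega>\<bar> + m / (m - 1) * (B \<omega>)\<^sup>2 + 1 / (m - 1) * v"
    proof -
      have "\<bar>x - y + z\<bar> \<le> \<bar>x\<bar> + y + z" if "0 \<le> y" "0 \<le> z" for x y z :: real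
        using that by linarith
      moreover have "\<bar>m / (m - 1) * A \<omega>\<bar> = m / (m - 1) * \<bar>A \<omega>\<bar>"
        using q(1) by (simp only: abs_mult abs_of_nonneg)
      moreover have "0 \<le> m / (m - 1) * (B \<omega>)\<^sup>2" "0 \<le> 1 / (m - 1) * v"
        using q v0 by (intro mult_nonneg_nonneg; simp)+
      ultimately show ?thesis
        by metis
    qed
    also have "\<dots> \<le> 2 * \<bar>A \<omega>\<bar> + 2 * (B \<omega>)\<^sup>2 + 2 / m * v"
      using q v0 by (intro add_mono mult_right_mono) auto
    finally show ?thesis
      by simp
  qed
  have "expectation (\<lambda>\<omega>. \<bar>sample_variance J (\<lambda>j. U j \<omega>) - v\<bar>)
      \<le> expectation (\<lambda>\<omega>. 2 * \<bar>A \<omega>\<bar> + 2 * (B \<omega>)\<^sup>2 + 2 * v / m)"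
    using expectation_sample_variance_le(1)[OF m meas int2 eq_refl[OF v]] A_abs B_int
    by (intro integral_mono pointwise) auto
  also have "\<dots> = 2 * expectation (\<lambda>\<omega>. \<bar>A \<omega>\<bar>) + 2 * (v / m) + 2 * v / m"
    using A_abs B_int by (simp add: B2 prob_space)
  also have "\<dots> \<le> 2 * sqrt (c / m) + 2 * (v / m) + 2 * v / m"
    using expectation_abs_le_sqrt[OF A_meas A_int] A2 by simp
  finally show ?thesis
    by (simp add: m_def)
qed

text \<open>Smallness of the errors \<open>D j\<close> in mean square, uniformly in \<open>j\<close>, makes their effect on the
  sample variance negligible in \<open>L\<^sup>1\<close>.\<close>
lemma (in prob_space) sample_variance_perturbation_L1:
  fixes U D :: "'i \<Rightarrow> 'a \<Rightarrow> real"
  assumes m: "2 \<le> card J" and e: "0 < e"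
    and U: "\<And>j. j \<in> J \<Longrightarrow> U j \<in> borel_measurable M"
      "\<And>j. j \<in> J \<Longrightarrow> integrable M (\<lambda>\<omega>. (U j \<omega>)\<^sup>2)"
      "\<And>j. j \<in> J \<Longrightarrow> expectation (\<lambda>\<omega>. (U j \<omega>)\<^sup>2) \<le> v"
    and D: "\<And>j. j \<in> J \<Longrightarrow> D j \<in> borel_measurable M"
      "\<And>j. j \<in> J \<Longrightarrow> integrable M (\<lambda>\<omega>. (D j \<omega>)\<^sup>2)"
      "\<And>j. j \<in> J \<Longrightarrow> expectation (\<lambda>\<omega>. (D j \<omega>)\<^sup>2) \<le> \<delta>"
  shows "integrable M (\<lambda>\<omega>. sample_variance J (\<lambda>j. U j \<omega> + D j \<omega>))"
    and "expectation (\<lambda>\<omega>. \<bar>sample_variance J (\<lambda>j. U j \<omega> + D j \<omega>) - sample_variance J (\<lambda>j. U j \<omega>)\<bar>)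
      \<le> e * (2 * v) + (1 + 1 / e) * (2 * \<delta>)"
proof -
  note sU = expectation_sample_variance_le[of J U, OF m U]
  note sD = expectation_sample_variance_le[of J D, OF m D]
  have UD_meas: "(\<lambda>\<omega>. U j \<omega> + D j \<omega>) \<in> borel_measurable M" if "j \<in> J" for j
    using U(1)[OF that] D(1)[OF that] by simp
  have UD_int: "integrable M (\<lambda>\<omega>. (U j \<omega> + D j \<omega>)\<^sup>2)" if "j \<in> J" for j
    using that U D by (intro integrable_square_add) auto
  have "finite J"
    using m by (auto intro: card_ge_0_finite)
  \<comment> \<open>The sum of the second moments serves as a common bound for them.\<close>
  then have "expectation (\<lambda>\<omega>. (U j \<omega> + D j \<omega>)\<^sup>2) \<le> (\<Sum>j\<in>J. expectation (\<lambda>\<omega>. (U j \<omega> + D j \<omega>)\<^sup>2))"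
    if "j \<in> J" for j
    using that by (intro member_le_sum) auto
  note sUD = expectation_sample_variance_le(1)[of J "\<lambda>j \<omega>. U j \<omega> + D j \<omega>", OF m UD_meas UD_int this]
  then show "integrable M (\<lambda>\<omega>. sample_variance J (\<lambda>j. U j \<omega> + D j \<omega>))" .
  have "expectation (\<lambda>\<omega>. \<bar>sample_variance J (\<lambda>j. U j \<omega> + D j \<omega>) - sample_variance J (\<lambda>j. U j \<omega>)\<bar>)
      \<le> expectation (\<lambda>\<omega>. e * sample_variance J (\<lambda>j. U j \<omega>) + (1 + 1 / e) * sample_variance J (\<lambda>j. D j \<omega>))"
    using sU(1) sD(1) sUD m e by (intro integral_mono sample_variance_perturbation) auto
  also have "\<dots> = e * expectation (\<lambda>\<omega>. sample_variance J (\<lambda>j. U j \<omega>))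
      + (1 + 1 / e) * expectation (\<lambda>\<omega>. sample_variance J (\<lambda>j. D j \<omega>))"
    using sU(1) sD(1) by simp
  also have "\<dots> \<le> e * (2 * v) + (1 + 1 / e) * (2 * \<delta>)"
    using sU(2) sD(2) e by (intro add_mono mult_left_mono) auto
  finally show "expectation (\<lambda>\<omega>. \<bar>sample_variance J (\<lambda>j. U j \<omega> + D j \<omega>) - sample_variance J (\<lambda>j. U j \<omega>)\<bar>)
      \<le> e * (2 * v) + (1 + 1 / e) * (2 * \<delta>)" .
qed

section \<open>Pseudo values and the pooled sample\<close>

text \<open>Observation \<open>l\<close> of the pooled sample is observation \<open>rank_of n1 l\<close> of the sample
  \<open>sample_of n1 l\<close>; this injective renumbering lets both samples be treated uniformly.\<close>
definition sample_of :: "nat \<Rightarrow> nat \<Rightarrow> nat" where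
  "sample_of n1 l = (if l \<le> n1 then 1 else 2)"

definition rank_of :: "nat \<Rightarrow> nat \<Rightarrow> nat" where
  "rank_of n1 l = (if l \<le> n1 then l else l - n1)"

lemma sample_of_in: "sample_of n1 l \<in> {1, 2}"
  by (simp add: sample_of_def)

lemma rank_of_pos: "1 \<le> l \<Longrightarrow> 1 \<le> rank_of n1 l"
  by (auto simp: rank_of_def)

lemma inj_sample_rank: "inj (\<lambda>l. (sample_of n1 l, rank_of n1 l))"
  by (auto simp: inj_def sample_of_def rank_of_def split: if_splits)

lemma pooled_sample_eq:
  "pooled_sample X n1 n2 \<omega> = (\<lambda>l\<in>{1..n1 + n2}. X (sample_of n1 l) (rank_of n1 l) \<omega>)"
  by (auto simp: pooled_sample_def sample_of_def rank_of_def fun_eq_iff restrict_def)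

lemma xi_eq: "xi h n1 x l = h (sample_of n1 l) (x l)"
  by (simp add: xi_def sample_of_def)

lemma linear_part_eq:
  "linear_part h n1 n2 x = (\<Sum>l\<in>{1..n1 + n2}. xi h n1 x l) / real (n1 + n2)"
proof -
  have "(\<Sum>l\<in>{1..n1 + n2}. xi h n1 x l) = (\<Sum>l\<in>{1..n1}. xi h n1 x l) + (\<Sum>l\<in>{n1 + 1..n1 + n2}. xi h n1 x l)"
    by (subst sum.union_disjoint[symmetric]) (auto intro!: sum.cong)
  also have "\<dots> = (\<Sum>i = 1..n1. h 1 (x i)) + (\<Sum>i = n1 + 1..n1 + n2. h 2 (x i))"
    by (intro arg_cong2[where f = "(+)"] sum.cong) (auto simp: xi_def)
  finally show ?thesis
    by (simp add: linear_part_def)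
qed

text \<open>\<open>n L\<^sub>n\<close> and \<open>(n - 1) L\<^bsub>n,-i\<^esub>\<close> are sums of scores that differ in the \<open>i\<close>-th one only, so the
  linear parts contribute exactly \<open>\<xi>\<^sub>i\<close>.\<close>
lemma pseudo_value_minus_xi:
  assumes "2 \<le> n1 + n2" "i \<in> {1..n1 + n2}"
  shows "pseudo_value T n1 n2 x i - xi h n1 x i
    = (real (n1 + n2) - 1) * (remainder T h n1 n2 x - remainder_omit T h n1 n2 x i)
      + remainder T h n1 n2 x"
proof -
  define n where "n = real (n1 + n2)"
  have n: "2 \<le> n"
    using assms by (simp add: n_def)
  define s where "s = (\<Sum>j\<in>{1..n1 + n2} - {i}. xi h n1 x j)"
  have L: "n * linear_part h n1 n2 x = xi h n1 x i + s"
    using n assms by (simp add: linear_part_eq n_def s_def sum.remove)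
  have "(n - 1) * linear_part_omit h n1 n2 x i = s"
    using n by (simp add: linear_part_omit_def n_def s_def)
  with L show ?thesis
    unfolding pseudo_value_def remainder_def remainder_omit_def n_def[symmetric]
    by (simp add: algebra_simps)
qed

lemma tau1_sq_hat_eq: "tau1_sq_hat T n1 n2 x = sample_variance {1..n1} (pseudo_value T n1 n2 x)"
  by (simp add: tau1_sq_hat_def sample_variance_def block_mean_def)

lemma tau2_sq_hat_eq:
  "tau2_sq_hat T n1 n2 x = sample_variance {n1 + 1..n1 + n2} (pseudo_value T n1 n2 x)"
  by (simp add: tau2_sq_hat_def sample_variance_def block_mean_def)

section \<open>Omitting an arbitrary or the last observation of a sample\<close>

text \<open>The cycle that lists the entries \<open>i, \<dots>, b\<close> of a sample with the \<open>i\<close>-th one last and the order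
  of the others kept. For this choice, omitting place \<open>b\<close> afterwards is literally the same as omitting
  place \<open>i\<close> before (\<open>omit_move_to_end\<close>).\<close>
definition move_to_end :: "nat \<Rightarrow> nat \<Rightarrow> nat \<Rightarrow> nat" where
  "move_to_end i b l = (if i \<le> l \<and> l < b then l + 1 else if l = b then i else l)"

lemma move_to_end_permutes:
  assumes "i \<le> b"
  shows "move_to_end i b permutes {i..b}"
proof (rule bij_imp_permutes)
  have "inj_on (move_to_end i b) {i..b}"
    by (auto simp: inj_on_def move_to_end_def split: if_splits)
  moreover have "move_to_end i b ` {i..b} \<subseteq> {i..b}"
    using assms by (auto simp: move_to_end_def)
  ultimately show "bij_betw (move_to_end i b) {i..b} {i..b}"
    by (simp add: bij_betw_def endo_inj_surj)
qed (use assms in \<open>auto simp: move_to_end_def\<close>)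

lemma omit_move_to_end:
  assumes "1 \<le> i" "i \<le> b" "b \<le> n"
  shows "omit n b (x \<circ> move_to_end i b) = omit n i x"
  using assms by (auto simp: omit_def move_to_end_def fun_eq_iff restrict_def)

lemma linear_part_permute:
  assumes "p permutes {1..n1} \<or> p permutes {n1 + 1..n1 + n2}"
  shows "linear_part h n1 n2 (x \<circ> p) = linear_part h n1 n2 x"
proof -
  have "(\<Sum>i = 1..n1. h 1 (x (p i))) = (\<Sum>i = 1..n1. h 1 (x i))"
    using assms
  proof
    assume "p permutes {1..n1}"
    from sum.permute[OF this, of "\<lambda>i. h 1 (x i)"] show ?thesis
      by (simp add: comp_def)
  next
    assume "p permutes {n1 + 1..n1 + n2}"
    then show ?thesis
      by (intro sum.cong refl) (simp add: permutes_not_in)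
  qed
  moreover have "(\<Sum>i = n1 + 1..n1 + n2. h 2 (x (p i))) = (\<Sum>i = n1 + 1..n1 + n2. h 2 (x i))"
    using assms
  proof
    assume "p permutes {n1 + 1..n1 + n2}"
    from sum.permute[OF this, of "\<lambda>i. h 2 (x i)"] show ?thesis
      by (simp add: comp_def)
  next
    assume "p permutes {1..n1}"
    then show ?thesis
      by (intro sum.cong refl) (simp add: permutes_not_in)
  qed
  ultimately show ?thesis
    by (simp add: linear_part_def)
qed

text \<open>The two alternatives for \<open>b\<close> say that it is the last place of the sample that contains place \<open>i\<close>.
  All parts of \<open>R\<^sub>n\<close> are invariant under the cycle by symmetry, and the omission of \<open>b\<close> turns into
  that of \<open>i\<close>.\<close>
lemma remainder_difference_move_to_end:
  assumes T: "two_sample_statistic S T" and n: "1 \<le> n1" "1 \<le> n2"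
    and x: "x \<in> space (PiM {1..n1 + n2} (\<lambda>_. S))"
    and i: "1 \<le> i" "i \<le> b" and b: "b = n1 \<or> (n1 < i \<and> b = n1 + n2)"
  defines "y \<equiv> x \<circ> move_to_end i b"
  shows "remainder T h n1 n2 y - remainder_omit T h n1 n2 y b
    = remainder T h n1 n2 x - remainder_omit T h n1 n2 x i"
proof -
  have p: "move_to_end i b permutes {1..n1} \<or> move_to_end i b permutes {n1 + 1..n1 + n2}"
    using b
  proof
    assume "b = n1"
    then show ?thesis
      using permutes_subset[OF move_to_end_permutes[OF i(2)], of "{1..n1}"] i by auto
  next
    assume "n1 < i \<and> b = n1 + n2"
    then show ?thesis
      using permutes_subset[OF move_to_end_permutes[OF i(2)], of "{n1 + 1..n1 + n2}"] i by auto
  qed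
  have T_eq: "T n1 n2 y = T n1 n2 x"
    using T n x p unfolding two_sample_statistic_def y_def by blast
  have L_eq: "linear_part h n1 n2 y = linear_part h n1 n2 x"
    unfolding y_def by (rule linear_part_permute[OF p])
  have range: "i \<in> {1..n1 + n2}" "b \<in> {1..n1 + n2}"
    using i b n by auto
  have same: "b \<le> n1 \<longleftrightarrow> i \<le> n1"
    using i b n by auto
  have y_b: "y b = x i"
    by (simp add: y_def move_to_end_def)
  have xi_b: "xi h n1 y b = xi h n1 x i"
    by (simp add: xi_def same y_b)
  have "(\<Sum>j\<in>{1..n1 + n2}. xi h n1 y j) = (\<Sum>j\<in>{1..n1 + n2}. xi h n1 x j)"
    using L_eq n by (simp add: linear_part_eq)
  then have "linear_part_omit h n1 n2 y b = linear_part_omit h n1 n2 x i"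
    using range xi_b by (simp add: linear_part_omit_def sum_diff1)
  moreover have "leave_one_out T n1 n2 y b = leave_one_out T n1 n2 x i"
    using i range by (simp add: leave_one_out_def same y_def omit_move_to_end)
  ultimately show ?thesis
    by (simp add: remainder_def remainder_omit_def T_eq L_eq)
qed

section \<open>Measurability of the remainders\<close>

lemma measurable_omit:
  assumes "i \<le> n"
  shows "omit n i \<in> measurable (PiM {1..n} (\<lambda>_. S)) (PiM {1..n - 1} (\<lambda>_. S))"
  unfolding omit_def[abs_def]
proof (rule measurable_restrict)
  fix l
  assume "l \<in> {1..n - 1}"
  then show "(\<lambda>x. if l < i then x l else x (l + 1)) \<in> measurable (PiM {1..n} (\<lambda>_. S)) S"
    using assms by (cases "l < i") (auto intro!: measurable_component_singleton)
qed

lemma measurable_xi: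
  assumes h: "\<And>i. i \<in> {1, 2} \<Longrightarrow> h i \<in> borel_measurable S" and l: "l \<in> {1..n}"
  shows "(\<lambda>x. xi h n1 x l) \<in> borel_measurable (PiM {1..n} (\<lambda>_. S))"
  unfolding xi_eq by (rule measurable_compose[OF measurable_component_singleton[OF l] h[OF sample_of_in]])

lemma measurable_remainder:
  assumes h: "\<And>i. i \<in> {1, 2} \<Longrightarrow> h i \<in> borel_measurable S"
    and T: "two_sample_statistic S T" and n: "1 \<le> n1" "1 \<le> n2"
  shows "remainder T h n1 n2 \<in> borel_measurable (PiM {1..n1 + n2} (\<lambda>_. S))"
  unfolding remainder_def[abs_def] linear_part_eq
  using T n unfolding two_sample_statistic_def
  by (intro borel_measurable_diff borel_measurable_divide borel_measurable_sum measurable_xi[OF h]) auto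

lemma measurable_remainder_omit:
  assumes h: "\<And>i. i \<in> {1, 2} \<Longrightarrow> h i \<in> borel_measurable S"
    and T: "two_sample_statistic S T" and n: "2 \<le> n1" "2 \<le> n2" and i: "i \<le> n1 + n2"
  shows "(\<lambda>x. remainder_omit T h n1 n2 x i) \<in> borel_measurable (PiM {1..n1 + n2} (\<lambda>_. S))"
proof -
  have "T (n1 - 1) n2 \<in> borel_measurable (PiM {1..n1 + n2 - 1} (\<lambda>_. S))"
    "T n1 (n2 - 1) \<in> borel_measurable (PiM {1..n1 + n2 - 1} (\<lambda>_. S))"
    using T[unfolded two_sample_statistic_def, rule_format, of "n1 - 1" n2]
      T[unfolded two_sample_statistic_def, rule_format, of n1 "n2 - 1"] n by simp_all
  then have "(\<lambda>x. leave_one_out T n1 n2 x i) \<in> borel_measurable (PiM {1..n1 + n2} (\<lambda>_. S))"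
    unfolding leave_one_out_def
    by (cases "i \<le> n1")
      (simp_all only: if_True if_False measurable_compose[OF measurable_omit[OF i]])
  then show ?thesis
    unfolding remainder_omit_def linear_part_omit_def
    by (intro borel_measurable_diff borel_measurable_times borel_measurable_sum measurable_xi[OF h]
        borel_measurable_const) auto
qed

section \<open>Exchangeability within each sample\<close>

context two_samples
begin

lemma sets_F: "i \<in> {1, 2} \<Longrightarrow> sets (F i) = sets S"
  using distribution[of i 1] by (metis order_refl sets_distr)

lemma prob_space_F: "i \<in> {1, 2} \<Longrightarrow> prob_space (F i)"
  using prob_space_distr[OF observation[of i 1]] distribution[of i 1] by simp

lemma integrable_observation_iff:
  assumes "i \<in> {1, 2}" "1 \<le> j" "g \<in> borel_measurable S"
  shows "integrable M (\<lambda>\<omega>. g (X i j \<omega>)) \<longleftrightarrow> integrable (F i) (g :: 'a \<Rightarrow> real)"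
  using integrable_distr_eq[OF observation[OF assms(1,2)] assms(3)] distribution[OF assms(1,2)] by simp

lemma expectation_observation:
  assumes "i \<in> {1, 2}" "1 \<le> j" "g \<in> borel_measurable S"
  shows "expectation (\<lambda>\<omega>. g (X i j \<omega>)) = (\<integral>x. (g x :: real) \<partial>F i)"
  using integral_distr[OF observation[OF assms(1,2)] assms(3)] distribution[OF assms(1,2)] by simp

lemma expectation_product_observations:
  fixes f g :: "'a \<Rightarrow> real"
  assumes a: "i \<in> {1, 2}" "1 \<le> j" and b: "k \<in> {1, 2}" "1 \<le> l" and ne: "(i, j) \<noteq> (k, l)"
    and meas: "f \<in> borel_measurable S" "g \<in> borel_measurable S"
    and int: "integrable (F i) f" "integrable (F k) g"
  shows "expectation (\<lambda>\<omega>. f (X i j \<omega>) * g (X k l \<omega>)) = (\<integral>x. f x \<partial>F i) * (\<integral>x. g x \<partial>F k)"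
proof -
  define Y where "Y q = (if q = (i, j) then f else g)" for q
  have "indep_vars (\<lambda>_. S) (\<lambda>(i, j). X i j) {(i, j), (k, l)}"
    using a b by (intro indep_vars_subset[OF independence]) auto
  then have "indep_vars (\<lambda>_. borel) (\<lambda>q \<omega>. Y q ((case q of (i, j) \<Rightarrow> X i j) \<omega>)) {(i, j), (k, l)}"
    by (rule indep_vars_compose2) (auto simp: Y_def meas)
  moreover have "integrable M (\<lambda>\<omega>. Y q ((case q of (i, j) \<Rightarrow> X i j) \<omega>))"
    if "q \<in> {(i, j), (k, l)}" for q
    using that ne int integrable_observation_iff a b meas by (auto simp: Y_def)
  ultimately have "expectation (\<lambda>\<omega>. \<Prod>q\<in>{(i, j), (k, l)}. Y q ((case q of (i, j) \<Rightarrow> X i j) \<omega>))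
      = (\<Prod>q\<in>{(i, j), (k, l)}. expectation (\<lambda>\<omega>. Y q ((case q of (i, j) \<Rightarrow> X i j) \<omega>)))"
    by (intro indep_vars_lebesgue_integral) auto
  then show ?thesis
    using ne expectation_observation[OF a meas(1)] expectation_observation[OF b meas(2)]
    by (auto simp: Y_def)
qed

text \<open>The joint law of all observations is the product over \<open>{1, 2} \<times> {1..}\<close>; selecting
  observations by an injective map \<open>f\<close> is a reindexing of this product. Taking the selection
  arbitrary covers the pooled sample and its permutations alike.\<close>
lemma distr_observations:
  assumes J: "inj_on f J" "f \<in> J \<rightarrow> {1, 2} \<times> {1..}"
  shows "distr M (PiM J (\<lambda>_. S)) (\<lambda>\<omega>. \<lambda>l\<in>J. X (fst (f l)) (snd (f l)) \<omega>) = PiM J (\<lambda>l. F (fst (f l)))"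
proof -
  define I :: "(nat \<times> nat) set" where "I = {1, 2} \<times> {1..}"
  have rv: "(case q of (i, j) \<Rightarrow> X i j) \<in> measurable M S" if "q \<in> I" for q
    using that observation by (auto simp: I_def)
  have law: "distr M S (case q of (i, j) \<Rightarrow> X i j) = F (fst q)" if "q \<in> I" for q
    using that distribution by (auto simp: I_def)
  have "distr M (PiM I (\<lambda>_. S)) (\<lambda>\<omega>. \<lambda>q\<in>I. (case q of (i, j) \<Rightarrow> X i j) \<omega>)
      = PiM I (\<lambda>q. distr M S (case q of (i, j) \<Rightarrow> X i j))"
    by (subst indep_vars_iff_distr_eq_PiM'[symmetric]) (use independence rv in \<open>auto simp: I_def\<close>)
  also have "\<dots> = PiM I (\<lambda>q. F (fst q))"
    by (intro PiM_cong refl law)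
  finally have joint: "distr M (PiM I (\<lambda>_. S)) (\<lambda>\<omega>. \<lambda>q\<in>I. (case q of (i, j) \<Rightarrow> X i j) \<omega>)
      = PiM I (\<lambda>q. F (fst q))" .
  have joint_meas: "(\<lambda>\<omega>. \<lambda>q\<in>I. (case q of (i, j) \<Rightarrow> X i j) \<omega>) \<in> measurable M (PiM I (\<lambda>_. S))"
    by (rule measurable_restrict) (rule rv)
  have fI: "f l \<in> I" if "l \<in> J" for l
    using that J by (auto simp: I_def)
  have reindex_meas: "(\<lambda>x. \<lambda>l\<in>J. x (f l)) \<in> measurable (PiM I (\<lambda>_. S)) (PiM J (\<lambda>_. S))"
    by (intro measurable_restrict measurable_component_singleton fI)
  have sets_J: "sets (PiM J (\<lambda>l. F (fst (f l)))) = sets (PiM J (\<lambda>_. S))"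
    by (intro sets_PiM_cong refl sets_F) (use fI in \<open>force simp: I_def mem_Times_iff\<close>)
  have "distr M (PiM J (\<lambda>_. S)) (\<lambda>\<omega>. \<lambda>l\<in>J. X (fst (f l)) (snd (f l)) \<omega>)
      = distr M (PiM J (\<lambda>_. S)) ((\<lambda>x. \<lambda>l\<in>J. x (f l)) \<circ> (\<lambda>\<omega>. \<lambda>q\<in>I. (case q of (i, j) \<Rightarrow> X i j) \<omega>))"
    using fI by (intro distr_cong refl) (auto simp: fun_eq_iff case_prod_beta restrict_def)
  also have "\<dots> = distr (PiM I (\<lambda>q. F (fst q))) (PiM J (\<lambda>_. S)) (\<lambda>x. \<lambda>l\<in>J. x (f l))"
    by (subst distr_distr[OF reindex_meas joint_meas, symmetric]) (simp add: joint)
  also have "\<dots> = distr (PiM I (\<lambda>q. F (fst q))) (PiM J (\<lambda>l. F (fst (f l)))) (\<lambda>x. \<lambda>l\<in>J. x (f l))"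
    by (intro distr_cong refl sets_J[symmetric])
  also have "\<dots> = PiM J (\<lambda>l. F (fst (f l)))"
  proof (rule distr_PiM_reindex[OF _ J(1)])
    show "prob_space (F (fst q))" if "q \<in> I" for q
      using prob_space_distr[OF rv[OF that]] law[OF that] by simp
    show "f \<in> J \<rightarrow> I"
      using fI by auto
  qed
  finally show ?thesis .
qed

lemma measurable_pooled_sample:
  "pooled_sample X n1 n2 \<in> measurable M (PiM {1..n1 + n2} (\<lambda>_. S))"
  unfolding pooled_sample_eq[abs_def]
  by (intro measurable_restrict observation sample_of_in rank_of_pos) auto

lemma pooled_sample_exchangeable:
  assumes p: "p permutes {1..n1 + n2}"
    and block: "\<And>l. l \<in> {1..n1 + n2} \<Longrightarrow> sample_of n1 (p l) = sample_of n1 l"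
  shows "distr M (PiM {1..n1 + n2} (\<lambda>_. S)) (\<lambda>\<omega>. pooled_sample X n1 n2 \<omega> \<circ> p)
    = distr M (PiM {1..n1 + n2} (\<lambda>_. S)) (pooled_sample X n1 n2)"
proof -
  define J where "J = {1..n1 + n2}"
  define f where "f l = (sample_of n1 l, rank_of n1 l)" for l
  have inj_f: "inj_on f A" for A
    using inj_sample_rank[of n1] unfolding f_def[abs_def] by (rule inj_on_subset) simp
  have f: "f \<in> J \<rightarrow> {1, 2} \<times> {1..}"
    using sample_of_in rank_of_pos by (auto simp: f_def J_def)
  have pJ: "p \<in> J \<rightarrow> J"
    using permutes_in_image[OF p] by (auto simp: J_def)
  have "(\<lambda>\<omega>. pooled_sample X n1 n2 \<omega> \<circ> p)
      = (\<lambda>\<omega>. \<lambda>l\<in>J. X (fst ((f \<circ> p) l)) (snd ((f \<circ> p) l)) \<omega>)"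
    using permutes_in_image[OF p]
    by (auto simp: pooled_sample_eq f_def J_def fun_eq_iff restrict_def)
  moreover have "distr M (PiM J (\<lambda>_. S)) (\<lambda>\<omega>. \<lambda>l\<in>J. X (fst ((f \<circ> p) l)) (snd ((f \<circ> p) l)) \<omega>)
      = PiM J (\<lambda>l. F (fst ((f \<circ> p) l)))"
    using f pJ permutes_inj_on[OF p]
    by (intro distr_observations comp_inj_on inj_f) auto
  moreover have "\<dots> = PiM J (\<lambda>l. F (fst (f l)))"
    using block by (intro PiM_cong refl) (auto simp: f_def J_def)
  moreover have "distr M (PiM J (\<lambda>_. S)) (pooled_sample X n1 n2) = PiM J (\<lambda>l. F (fst (f l)))"
    using distr_observations[OF inj_f f] by (simp add: pooled_sample_eq[abs_def] f_def J_def)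
  ultimately show ?thesis
    by (simp add: J_def)
qed

text \<open>Moving observation \<open>i\<close> to the end of its sample changes neither the law of the pooled sample nor
  the value of the remainder difference, up to replacing \<open>i\<close> by \<open>b\<close>. Equality in \<open>[0, \<infinity>]\<close> also transfers square
  integrability from \<open>b\<close> to \<open>i\<close>.\<close>
lemma second_moment_remainder_difference:
  assumes h: "\<And>i. i \<in> {1, 2} \<Longrightarrow> h i \<in> borel_measurable S"
    and T: "two_sample_statistic S T" and n: "2 \<le> n1" "2 \<le> n2"
    and i: "1 \<le> i" "i \<le> b" and b: "b = n1 \<or> (n1 < i \<and> b = n1 + n2)"
  defines "Z \<equiv> pooled_sample X n1 n2"
  shows "second_moment M (\<lambda>\<omega>. remainder T h n1 n2 (Z \<omega>) - remainder_omit T h n1 n2 (Z \<omega>) i)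
    = second_moment M (\<lambda>\<omega>. remainder T h n1 n2 (Z \<omega>) - remainder_omit T h n1 n2 (Z \<omega>) b)"
proof -
  define P where "P = PiM {1..n1 + n2} (\<lambda>_. S)"
  define p where "p = move_to_end i b"
  define G where "G x = remainder T h n1 n2 x - remainder_omit T h n1 n2 x b" for x
  have b_le: "b \<le> n1 + n2"
    using b by auto
  have p_perm: "p permutes {1..n1 + n2}"
    unfolding p_def using i b_le by (intro permutes_subset[OF move_to_end_permutes]) auto
  have block: "sample_of n1 (p l) = sample_of n1 l" for l
    using i b n by (auto simp: p_def move_to_end_def sample_of_def)
  have Z_meas: "Z \<in> measurable M P"
    unfolding Z_def P_def by (rule measurable_pooled_sample)
  have perm_meas: "(\<lambda>x. x \<circ> p) \<in> measurable P P"
  proof -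
    have "(\<lambda>x. \<lambda>l\<in>{1..n1 + n2}. x (p l)) \<in> measurable P P"
      unfolding P_def
      using permutes_in_image[OF p_perm] by (intro measurable_restrict measurable_component_singleton) auto
    moreover have "x \<circ> p = (\<lambda>l\<in>{1..n1 + n2}. x (p l))" if "x \<in> space P" for x
      using that permutes_not_in[OF p_perm]
      by (auto simp: P_def space_PiM PiE_def extensional_def fun_eq_iff restrict_def)
    ultimately show ?thesis
      by (subst measurable_cong) auto
  qed
  have G_meas: "G \<in> borel_measurable P"
    unfolding G_def[abs_def] P_def
    using n b_le by (intro borel_measurable_diff measurable_remainder measurable_remainder_omit h T) auto
  have sm: "second_moment M (\<lambda>\<omega>. G (Y \<omega>)) = (\<integral>\<^sup>+x. ennreal ((G x)\<^sup>2) \<partial>distr M P Y)"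
    if "Y \<in> measurable M P" for Y
    unfolding second_moment_def using G_meas by (subst nn_integral_distr[OF that]) auto
  have "second_moment M (\<lambda>\<omega>. remainder T h n1 n2 (Z \<omega>) - remainder_omit T h n1 n2 (Z \<omega>) i)
      = second_moment M (\<lambda>\<omega>. G (Z \<omega> \<circ> p))"
    unfolding second_moment_def
  proof (intro nn_integral_cong)
    fix \<omega>
    assume "\<omega> \<in> space M"
    then have "Z \<omega> \<in> space (PiM {1..n1 + n2} (\<lambda>_. S))"
      using measurable_space[OF Z_meas] by (simp add: P_def)
    from remainder_difference_move_to_end[OF T _ _ this i b, of h] n
    show "ennreal ((remainder T h n1 n2 (Z \<omega>) - remainder_omit T h n1 n2 (Z \<omega>) i)\<^sup>2)
        = ennreal ((G (Z \<omega> \<circ> p))\<^sup>2)"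
      by (simp add: G_def p_def)
  qed
  also have "\<dots> = second_moment M (\<lambda>\<omega>. G (Z \<omega>))"
    unfolding sm[OF Z_meas] sm[OF measurable_compose[OF Z_meas perm_meas]]
    using pooled_sample_exchangeable[OF p_perm block] by (simp only: P_def Z_def)
  finally show ?thesis
    by (simp add: G_def)
qed

lemma fourth_moment_integrable:
  assumes i: "i \<in> {1, 2}" and meas: "(f :: 'a \<Rightarrow> real) \<in> borel_measurable S"
    and int: "integrable (F i) (\<lambda>x. (f x) ^ 4)"
  shows "integrable (F i) (\<lambda>x. (f x)\<^sup>2)" and "integrable (F i) f"
proof -
  interpret F: prob_space "F i"
    by (rule prob_space_F[OF i])
  have f: "f \<in> borel_measurable (F i)"
    using meas measurable_cong_sets[OF sets_F[OF i] refl] by blast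
  then have "(\<lambda>x. (f x)\<^sup>2) \<in> borel_measurable (F i)"
    by simp
  then show f2: "integrable (F i) (\<lambda>x. (f x)\<^sup>2)"
    by (rule F.square_integrable_imp_integrable) (use int in simp)
  show "integrable (F i) f"
    by (rule F.square_integrable_imp_integrable[OF f f2])
qed

end

section \<open>Centred scores\<close>

locale two_sample_scores = two_samples M S F X
  for M :: "'w measure" and S :: "'a measure" and F :: "nat \<Rightarrow> 'a measure"
    and X :: "nat \<Rightarrow> nat \<Rightarrow> 'w \<Rightarrow> 'a" +
  fixes h :: "nat \<Rightarrow> 'a \<Rightarrow> real"
  assumes h_meas: "\<And>i. i \<in> {1, 2} \<Longrightarrow> h i \<in> borel_measurable S"
    and h_fourth: "\<And>i. i \<in> {1, 2} \<Longrightarrow> integrable (F i) (\<lambda>x. (h i x) ^ 4)"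
    and h_centered: "\<And>i. i \<in> {1, 2} \<Longrightarrow> (\<integral>x. h i x \<partial>F i) = 0"
begin

definition score_variance :: "nat \<Rightarrow> real" where
  "score_variance i = (\<integral>x. (h i x)\<^sup>2 \<partial>F i)"

definition score :: "nat \<Rightarrow> nat \<Rightarrow> nat \<Rightarrow> 'w \<Rightarrow> real" where
  "score n1 n2 l \<omega> = xi h n1 (pooled_sample X n1 n2 \<omega>) l"

lemma score_eq:
  assumes "l \<in> {1..n1 + n2}"
  shows "score n1 n2 l = (\<lambda>\<omega>. h (sample_of n1 l) (X (sample_of n1 l) (rank_of n1 l) \<omega>))"
  using assms by (simp add: score_def xi_eq pooled_sample_eq fun_eq_iff)

lemma
  assumes i: "i \<in> {1, 2}"
  shows h_square_integrable: "integrable (F i) (\<lambda>x. (h i x)\<^sup>2)"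
    and h_integrable: "integrable (F i) (h i)"
  by (rule fourth_moment_integrable[OF i h_meas[OF i] h_fourth[OF i]])+

lemma h_square_deviation_integrable:
  assumes i: "i \<in> {1, 2}"
  shows "integrable (F i) (\<lambda>x. ((h i x)\<^sup>2 - v)\<^sup>2)"
proof -
  interpret F: prob_space "F i"
    by (rule prob_space_F[OF i])
  show ?thesis
    unfolding power2_diff using h_fourth[OF i] h_square_integrable[OF i] by simp
qed

lemma
  assumes l: "l \<in> {1..n1 + n2}"
  shows score_measurable: "score n1 n2 l \<in> borel_measurable M"
    and score_integrable: "integrable M (score n1 n2 l)"
    and score_square_integrable: "integrable M (\<lambda>\<omega>. (score n1 n2 l \<omega>)\<^sup>2)"
    and score_square_deviation_integrable: "integrable M (\<lambda>\<omega>. ((score n1 n2 l \<omega>)\<^sup>2 - v)\<^sup>2)"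
    and expectation_score: "expectation (score n1 n2 l) = 0"
    and expectation_score_square:
      "expectation (\<lambda>\<omega>. (score n1 n2 l \<omega>)\<^sup>2) = score_variance (sample_of n1 l)"
    and expectation_score_square_deviation:
      "expectation (\<lambda>\<omega>. ((score n1 n2 l \<omega>)\<^sup>2 - v)\<^sup>2)
        = (\<integral>x. ((h (sample_of n1 l) x)\<^sup>2 - v)\<^sup>2 \<partial>F (sample_of n1 l))"
proof -
  define i where "i = sample_of n1 l"
  have i: "i \<in> {1, 2}"
    unfolding i_def by (rule sample_of_in)
  have j: "1 \<le> rank_of n1 l"
    using l by (intro rank_of_pos) simp
  note eq = score_eq[OF l, folded i_def]
  have meas: "h i \<in> borel_measurable S" "(\<lambda>x. (h i x)\<^sup>2) \<in> borel_measurable S"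
    "(\<lambda>x. ((h i x)\<^sup>2 - v)\<^sup>2) \<in> borel_measurable S"
    using h_meas[OF i] by simp_all
  note int = meas[THEN integrable_observation_iff[OF i j]]
  note E = meas[THEN expectation_observation[OF i j]]
  show "score n1 n2 l \<in> borel_measurable M"
    unfolding eq by (rule measurable_compose[OF observation[OF i j] meas(1)])
  show "integrable M (score n1 n2 l)"
    unfolding eq using int(1) h_integrable[OF i] by simp
  show "integrable M (\<lambda>\<omega>. (score n1 n2 l \<omega>)\<^sup>2)"
    unfolding eq using int(2) h_square_integrable[OF i] by simp
  show "integrable M (\<lambda>\<omega>. ((score n1 n2 l \<omega>)\<^sup>2 - v)\<^sup>2)"
    unfolding eq using int(3) h_square_deviation_integrable[OF i] by simp
  show "expectation (score n1 n2 l) = 0"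
    unfolding eq using E(1) h_centered[OF i] by simp
  show "expectation (\<lambda>\<omega>. (score n1 n2 l \<omega>)\<^sup>2) = score_variance (sample_of n1 l)"
    unfolding eq score_variance_def using E(2) by (simp add: i_def)
  show "expectation (\<lambda>\<omega>. ((score n1 n2 l \<omega>)\<^sup>2 - v)\<^sup>2)
      = (\<integral>x. ((h (sample_of n1 l) x)\<^sup>2 - v)\<^sup>2 \<partial>F (sample_of n1 l))"
    unfolding eq using E(3) by (simp add: i_def)
qed

lemma
  assumes l: "l \<in> {1..n1 + n2}" and l': "l' \<in> {1..n1 + n2}" and ne: "l \<noteq> l'"
  shows scores_orthogonal: "expectation (\<lambda>\<omega>. score n1 n2 l \<omega> * score n1 n2 l' \<omega>) = 0"
    and score_squares_orthogonal:
      "expectation (\<lambda>\<omega>. ((score n1 n2 l \<omega>)\<^sup>2 - score_variance (sample_of n1 l))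
        * ((score n1 n2 l' \<omega>)\<^sup>2 - score_variance (sample_of n1 l'))) = 0"
proof -
  define i j where "i = sample_of n1 l" and "j = sample_of n1 l'"
  have ij: "i \<in> {1, 2}" "j \<in> {1, 2}"
    unfolding i_def j_def by (rule sample_of_in)+
  have ranks: "1 \<le> rank_of n1 l" "1 \<le> rank_of n1 l'"
    using l l' by (simp_all only: atLeastAtMost_iff rank_of_pos)
  have ne': "(i, rank_of n1 l) \<noteq> (j, rank_of n1 l')"
    using injD[OF inj_sample_rank[of n1], of l l'] ne by (auto simp: i_def j_def)
  note product = expectation_product_observations[OF ij(1) ranks(1) ij(2) ranks(2) ne']
  note eq = score_eq[OF l, folded i_def] score_eq[OF l', folded j_def]
  show "expectation (\<lambda>\<omega>. score n1 n2 l \<omega> * score n1 n2 l' \<omega>) = 0"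
    unfolding eq using product[OF h_meas h_meas h_integrable h_integrable] ij h_centered by simp
  define g where "g k x = (h k x)\<^sup>2 - score_variance k" for k x
  have g_meas: "g k \<in> borel_measurable S" if "k \<in> {1, 2}" for k
    unfolding g_def[abs_def] using h_meas[OF that] by simp
  have g_int: "integrable (F k) (g k)" and g_centered: "(\<integral>x. g k x \<partial>F k) = 0"
    if k: "k \<in> {1, 2}" for k
  proof -
    interpret F: prob_space "F k"
      by (rule prob_space_F[OF k])
    show "integrable (F k) (g k)" "(\<integral>x. g k x \<partial>F k) = 0"
      using h_square_integrable[OF k]
      by (simp_all add: g_def[abs_def] score_variance_def F.prob_space)
  qed
  show "expectation (\<lambda>\<omega>. ((score n1 n2 l \<omega>)\<^sup>2 - score_variance (sample_of n1 l))
      * ((score n1 n2 l' \<omega>)\<^sup>2 - score_variance (sample_of n1 l'))) = 0"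
    using product[OF g_meas g_meas g_int g_int] ij g_centered
    by (simp add: eq g_def flip: i_def j_def)
qed

lemma variance_observation:
  assumes "i \<in> {1, 2}"
  shows "variance (\<lambda>\<omega>. h i (X i 1 \<omega>)) = score_variance i"
proof -
  have "expectation (\<lambda>\<omega>. h i (X i 1 \<omega>)) = 0"
    using expectation_observation[OF assms order_refl h_meas[OF assms]] h_centered[OF assms] by simp
  then show ?thesis
    using expectation_observation[OF assms order_refl, of "\<lambda>x. (h i x)\<^sup>2"] h_meas[OF assms]
    by (simp add: score_variance_def)
qed

lemma linear_part_score:
  "linear_part h n1 n2 (pooled_sample X n1 n2 \<omega>) = (\<Sum>l\<in>{1..n1 + n2}. score n1 n2 l \<omega>) / real (n1 + n2)"
  by (simp add: linear_part_eq score_def)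

lemma linear_part_moments:
  fixes n1 n2 :: nat
  assumes n: "1 \<le> n1"
  defines "L \<equiv> \<lambda>\<omega>. linear_part h n1 n2 (pooled_sample X n1 n2 \<omega>)"
  shows "L \<in> borel_measurable M" and "integrable M (\<lambda>\<omega>. (L \<omega>)\<^sup>2)" and "expectation L = 0"
    and "real (n1 + n2) * expectation (\<lambda>\<omega>. (L \<omega>)\<^sup>2)
      = real n1 / real (n1 + n2) * score_variance 1 + real n2 / real (n1 + n2) * score_variance 2"
proof -
  show "L \<in> borel_measurable M"
    unfolding L_def linear_part_score
    by (intro borel_measurable_divide borel_measurable_sum score_measurable borel_measurable_const)
  show "integrable M (\<lambda>\<omega>. (L \<omega>)\<^sup>2)"
    unfolding L_def linear_part_score power_divide
    by (intro integrable_divide integrable_square_sum score_measurable score_square_integrable)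
  show "expectation L = 0"
    unfolding L_def linear_part_score
    using score_integrable expectation_score by (simp add: Bochner_Integration.integral_sum)
  have "expectation (\<lambda>\<omega>. (\<Sum>l\<in>{1..n1 + n2}. score n1 n2 l \<omega>)\<^sup>2)
      = (\<Sum>l\<in>{1..n1 + n2}. score_variance (sample_of n1 l))"
    by (subst expectation_square_sum_orthogonal)
      (auto intro!: score_measurable score_square_integrable scores_orthogonal expectation_score_square sum.cong)
  also have "\<dots> = (\<Sum>l\<in>{1..n1}. score_variance (sample_of n1 l))
      + (\<Sum>l\<in>{n1 + 1..n1 + n2}. score_variance (sample_of n1 l))"
    by (subst sum.union_disjoint[symmetric]) (auto intro!: sum.cong)
  also have "\<dots> = real n1 * score_variance 1 + real n2 * score_variance 2"
    by (simp add: sample_of_def)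
  finally have "expectation (\<lambda>\<omega>. (L \<omega>)\<^sup>2)
      = (real n1 * score_variance 1 + real n2 * score_variance 2) / (real (n1 + n2))\<^sup>2"
    unfolding L_def linear_part_score power_divide by simp
  moreover have "0 < real (n1 + n2)"
    using n by simp
  ultimately show "real (n1 + n2) * expectation (\<lambda>\<omega>. (L \<omega>)\<^sup>2)
      = real n1 / real (n1 + n2) * score_variance 1 + real n2 / real (n1 + n2) * score_variance 2"
    by (simp only: power2_eq_square) (simp add: field_simps)
qed

text \<open>Apply \<open>(a + b)\<^sup>2 \<le> 2 a\<^sup>2 + 2 b\<^sup>2\<close> to \<open>pseudo_value_minus_xi\<close> and use exchangeability to replace \<open>i\<close> by the
  last place of its sample. The bound contains both last places in order to be uniform in \<open>i\<close>.\<close>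
lemma score_error_bound:
  assumes T: "two_sample_statistic S T" and n: "2 \<le> n1" "2 \<le> n2"
    and i: "i \<in> {1..n1 + n2}"
  defines "Z \<equiv> pooled_sample X n1 n2"
  defines "R \<equiv> \<lambda>\<omega>. remainder T h n1 n2 (Z \<omega>)"
    and "\<Delta> \<equiv> \<lambda>l \<omega>. remainder T h n1 n2 (Z \<omega>) - remainder_omit T h n1 n2 (Z \<omega>) l"
    and "D \<equiv> \<lambda>\<omega>. pseudo_value T n1 n2 (Z \<omega>) i - xi h n1 (Z \<omega>) i"
  assumes int: "integrable M (\<lambda>\<omega>. (R \<omega>)\<^sup>2)" "integrable M (\<lambda>\<omega>. (\<Delta> n1 \<omega>)\<^sup>2)"
    "integrable M (\<lambda>\<omega>. (\<Delta> (n1 + n2) \<omega>)\<^sup>2)"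
  shows "D \<in> borel_measurable M" and "integrable M (\<lambda>\<omega>. (D \<omega>)\<^sup>2)"
    and "expectation (\<lambda>\<omega>. (D \<omega>)\<^sup>2) \<le>
      2 * (real ((n1 + n2)\<^sup>2) * expectation (\<lambda>\<omega>. (\<Delta> n1 \<omega>)\<^sup>2)
        + real ((n1 + n2)\<^sup>2) * expectation (\<lambda>\<omega>. (\<Delta> (n1 + n2) \<omega>)\<^sup>2))
      + 2 * expectation (\<lambda>\<omega>. (R \<omega>)\<^sup>2)"
proof -
  define b where "b = (if i \<le> n1 then n1 else n1 + n2)"
  have b: "1 \<le> i" "i \<le> b" "b = n1 \<or> (n1 < i \<and> b = n1 + n2)"
    using i by (auto simp: b_def)
  define c where "c = real (n1 + n2) - 1"
  have R_meas: "R \<in> borel_measurable M"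
    unfolding R_def Z_def
    using n by (intro measurable_compose[OF measurable_pooled_sample] measurable_remainder h_meas T) auto
  have \<Delta>_meas: "\<Delta> l \<in> borel_measurable M" if "l \<le> n1 + n2" for l
    unfolding \<Delta>_def Z_def using n that
    by (intro borel_measurable_diff measurable_compose[OF measurable_pooled_sample]
        measurable_remainder measurable_remainder_omit h_meas T) auto
  have D_eq: "D \<omega> = c * \<Delta> i \<omega> + R \<omega>" for \<omega>
    unfolding D_def R_def \<Delta>_def c_def using n i by (intro pseudo_value_minus_xi) auto
  have i_le: "i \<le> n1 + n2"
    using i by simp
  show D_meas: "D \<in> borel_measurable M"
    unfolding D_eq[abs_def] using \<Delta>_meas[OF i_le] R_meas by measurable
  have int_b: "integrable M (\<lambda>\<omega>. (\<Delta> b \<omega>)\<^sup>2)"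
    using int by (simp add: b_def)
  have sm: "second_moment M (\<Delta> i) = second_moment M (\<Delta> b)"
    unfolding \<Delta>_def Z_def by (rule second_moment_remainder_difference[OF h_meas T n b])
  have int_i: "integrable M (\<lambda>\<omega>. (\<Delta> i \<omega>)\<^sup>2)"
    using \<Delta>_meas[OF i_le]
    by (rule square_integrable_if_second_moment_finite)
      (simp add: sm second_moment_eq_expectation[OF int_b])
  have E_i: "expectation (\<lambda>\<omega>. (\<Delta> i \<omega>)\<^sup>2) = expectation (\<lambda>\<omega>. (\<Delta> b \<omega>)\<^sup>2)"
    using sm by (simp add: second_moment_eq_expectation int_i int_b)
  have int_ci: "integrable M (\<lambda>\<omega>. (c * \<Delta> i \<omega>)\<^sup>2)"
    using int_i by (simp add: power_mult_distrib)
  show D_int: "integrable M (\<lambda>\<omega>. (D \<omega>)\<^sup>2)"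
    unfolding D_eq using \<Delta>_meas[OF i_le] R_meas int_ci int(1) by (intro integrable_square_add) auto
  have "expectation (\<lambda>\<omega>. (D \<omega>)\<^sup>2) \<le> expectation (\<lambda>\<omega>. 2 * c\<^sup>2 * (\<Delta> i \<omega>)\<^sup>2 + 2 * (R \<omega>)\<^sup>2)"
  proof (intro integral_mono D_int)
    fix \<omega>
    show "(D \<omega>)\<^sup>2 \<le> 2 * c\<^sup>2 * (\<Delta> i \<omega>)\<^sup>2 + 2 * (R \<omega>)\<^sup>2"
      using sum_squares_bound[of "c * \<Delta> i \<omega>" "R \<omega>"]
      by (simp add: D_eq power2_sum power_mult_distrib)
  qed (use int_i int(1) in auto)
  also have "\<dots> = 2 * (c\<^sup>2 * expectation (\<lambda>\<omega>. (\<Delta> b \<omega>)\<^sup>2)) + 2 * expectation (\<lambda>\<omega>. (R \<omega>)\<^sup>2)"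
    using int_i int(1) by (simp add: E_i)
  also have "\<dots> \<le> 2 * (real ((n1 + n2)\<^sup>2) * expectation (\<lambda>\<omega>. (\<Delta> b \<omega>)\<^sup>2)) + 2 * expectation (\<lambda>\<omega>. (R \<omega>)\<^sup>2)"
    using n by (intro add_right_mono mult_left_mono mult_right_mono)
      (auto simp: c_def of_nat_power intro!: power_mono)
  also have "\<dots> \<le> 2 * (real ((n1 + n2)\<^sup>2) * expectation (\<lambda>\<omega>. (\<Delta> n1 \<omega>)\<^sup>2)
        + real ((n1 + n2)\<^sup>2) * expectation (\<lambda>\<omega>. (\<Delta> (n1 + n2) \<omega>)\<^sup>2))
      + 2 * expectation (\<lambda>\<omega>. (R \<omega>)\<^sup>2)"
    by (auto simp: b_def)
  finally show "expectation (\<lambda>\<omega>. (D \<omega>)\<^sup>2) \<le>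
      2 * (real ((n1 + n2)\<^sup>2) * expectation (\<lambda>\<omega>. (\<Delta> n1 \<omega>)\<^sup>2)
        + real ((n1 + n2)\<^sup>2) * expectation (\<lambda>\<omega>. (\<Delta> (n1 + n2) \<omega>)\<^sup>2))
      + 2 * expectation (\<lambda>\<omega>. (R \<omega>)\<^sup>2)" .
qed

text \<open>\<open>J k\<close> is the set of places of one of the samples at stage \<open>k\<close>, and \<open>D\<close> will be the difference of
  pseudo values and scores. Through \<open>D\<close> the sample variance differs negligibly from that of the scores,
  which are centred and uncorrelated with common variance, so that its limit is \<open>score_variance i\<close>.\<close>
lemma block_sample_variance_tendsto:
  fixes n1 n2 :: "nat \<Rightarrow> nat" and J :: "nat \<Rightarrow> nat set" and D :: "nat \<Rightarrow> nat \<Rightarrow> 'w \<Rightarrow> real"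
  assumes J: "\<And>k. J k \<subseteq> {1..n1 k + n2 k}" "\<And>k j. j \<in> J k \<Longrightarrow> sample_of (n1 k) j = i"
    and size: "filterlim (\<lambda>k. card (J k)) at_top sequentially"
    and D: "\<forall>\<^sub>F k in sequentially. \<forall>j\<in>J k. D k j \<in> borel_measurable M \<and>
      integrable M (\<lambda>\<omega>. (D k j \<omega>)\<^sup>2) \<and> expectation (\<lambda>\<omega>. (D k j \<omega>)\<^sup>2) \<le> \<delta> k"
    and \<delta>: "\<delta> \<longlonglongrightarrow> 0"
  defines "V \<equiv> \<lambda>k \<omega>. sample_variance (J k) (\<lambda>j. score (n1 k) (n2 k) j \<omega> + D k j \<omega>)"
  shows "\<forall>\<^sub>F k in sequentially. integrable M (V k)"
    and "(\<lambda>k. expectation (\<lambda>\<omega>. \<bar>V k \<omega> - score_variance i\<bar>)) \<longlonglongrightarrow> 0"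
proof -
  define v where "v = score_variance i"
  define c where "c = (\<integral>x. ((h i x)\<^sup>2 - v)\<^sup>2 \<partial>F i)"
  define W where "W k \<omega> = sample_variance (J k) (\<lambda>j. score (n1 k) (n2 k) j \<omega>)" for k \<omega>
  \<comment> \<open>The error splits into the effect \<open>\<gamma>\<close> of \<open>D\<close> and the error of the unperturbed sample variance.\<close>
  define \<gamma> where "\<gamma> k = expectation (\<lambda>\<omega>. \<bar>V k \<omega> - W k \<omega>\<bar>)" for k
  have in_range: "j \<in> {1..n1 k + n2 k}" if "j \<in> J k" for j k
    using J(1) that by blast
  have U: "score (n1 k) (n2 k) j \<in> borel_measurable M" "integrable M (\<lambda>\<omega>. (score (n1 k) (n2 k) j \<omega>)\<^sup>2)"
    "expectation (\<lambda>\<omega>. (score (n1 k) (n2 k) j \<omega>)\<^sup>2) = v" if "j \<in> J k" for j k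
    using score_measurable score_square_integrable expectation_score_square in_range[OF that] J(2)[OF that]
    by (auto simp: v_def)
  have big: "\<forall>\<^sub>F k in sequentially. 2 \<le> card (J k)"
    using size by (simp add: filterlim_at_top)
  have pert: "\<forall>\<^sub>F k in sequentially. integrable M (V k) \<and> \<gamma> k \<le> e * (2 * v) + (1 + 1 / e) * (2 * \<delta> k)"
    if e: "0 < e" for e
    using big D
  proof eventually_elim
    case (elim k)
    then show ?case
      unfolding V_def W_def \<gamma>_def
      using sample_variance_perturbation_L1[of "J k" e "score (n1 k) (n2 k)" v "D k" "\<delta> k"] e U
      by auto
  qed
  show V_int: "\<forall>\<^sub>F k in sequentially. integrable M (V k)"
    using pert[of 1] by (auto elim: eventually_mono)
  have \<gamma>_nonneg: "0 \<le> \<gamma> k" for k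
    by (simp add: \<gamma>_def)
  have \<gamma>: "\<gamma> \<longlonglongrightarrow> 0"
  proof (rule tendsto_zero_of_perturbation_bound)
    show "\<forall>\<^sub>F k in sequentially. \<bar>\<gamma> k\<bar> \<le> e * (2 * v) + (1 + 1 / e) * (2 * \<delta> k)" if "0 < e" for e
      using pert[OF that] \<gamma>_nonneg by (auto elim!: eventually_mono)
    show "(\<lambda>k. 2 * \<delta> k) \<longlonglongrightarrow> 0"
      using tendsto_mult_right_zero[OF \<delta>] by simp
  qed (rule tendsto_const)
  have card_lim: "filterlim (\<lambda>k. real (card (J k))) at_top sequentially"
    by (rule filterlim_compose[OF filterlim_real_sequentially size])
  have inv: "(\<lambda>k. a / real (card (J k))) \<longlonglongrightarrow> 0" for a
    using tendsto_divide_0[OF tendsto_const filterlim_at_top_imp_at_infinity[OF card_lim]] .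
  show "(\<lambda>k. expectation (\<lambda>\<omega>. \<bar>V k \<omega> - score_variance i\<bar>)) \<longlonglongrightarrow> 0"
  proof (rule tendsto_sandwich[OF _ _ tendsto_const])
    have "(\<lambda>k. \<gamma> k + (2 * sqrt (c / card (J k)) + 4 * v / card (J k))) \<longlonglongrightarrow> 0 + (2 * sqrt 0 + 0)"
      by (intro tendsto_intros \<gamma> inv)
    then show "(\<lambda>k. \<gamma> k + (2 * sqrt (c / card (J k)) + 4 * v / card (J k))) \<longlonglongrightarrow> 0"
      by simp
    show "\<forall>\<^sub>F k in sequentially. expectation (\<lambda>\<omega>. \<bar>V k \<omega> - score_variance i\<bar>)
        \<le> \<gamma> k + (2 * sqrt (c / card (J k)) + 4 * v / card (J k))"
      using big V_int
    proof eventually_elim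
      case (elim k)
      have W_int: "integrable M (W k)"
        unfolding W_def[abs_def]
        using expectation_sample_variance_le(1)[OF elim(1) U(1) U(2) eq_refl[OF U(3)]] .
      have "expectation (\<lambda>\<omega>. \<bar>W k \<omega> - v\<bar>) \<le> 2 * sqrt (c / card (J k)) + 4 * v / card (J k)"
        unfolding W_def
      proof (rule sample_variance_L1_error[OF elim(1) U(1) U(2) _ U(3)])
        fix j
        assume j: "j \<in> J k"
        show "integrable M (\<lambda>\<omega>. ((score (n1 k) (n2 k) j \<omega>)\<^sup>2 - v)\<^sup>2)"
          by (rule score_square_deviation_integrable[OF in_range[OF j]])
        show "expectation (\<lambda>\<omega>. ((score (n1 k) (n2 k) j \<omega>)\<^sup>2 - v)\<^sup>2) = c"
          using expectation_score_square_deviation[OF in_range[OF j]] J(2)[OF j] by (simp add: c_def)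
        fix l
        assume l: "l \<in> J k" "l \<noteq> j"
        show "expectation (\<lambda>\<omega>. score (n1 k) (n2 k) l \<omega> * score (n1 k) (n2 k) j \<omega>) = 0"
          by (rule scores_orthogonal[OF in_range[OF l(1)] in_range[OF j] l(2)])
        show "expectation (\<lambda>\<omega>. ((score (n1 k) (n2 k) l \<omega>)\<^sup>2 - v) * ((score (n1 k) (n2 k) j \<omega>)\<^sup>2 - v)) = 0"
          using score_squares_orthogonal[OF in_range[OF l(1)] in_range[OF j] l(2)] J(2)[OF j] J(2)[OF l(1)]
          by (simp add: v_def)
      qed auto
      moreover have "expectation (\<lambda>\<omega>. \<bar>V k \<omega> - v\<bar>) \<le> expectation (\<lambda>\<omega>. \<bar>V k \<omega> - W k \<omega>\<bar> + \<bar>W k \<omega> - v\<bar>)"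
        using elim(2) W_int by (intro integral_mono) auto
      moreover have "\<dots> = \<gamma> k + expectation (\<lambda>\<omega>. \<bar>W k \<omega> - v\<bar>)"
        using elim(2) W_int by (simp add: \<gamma>_def)
      ultimately show ?case
        by (simp add: v_def)
    qed
  qed simp
qed

end

section \<open>Consistency of the jackknife\<close>

theorem theorem2p1:
  fixes M :: "'w measure" and S :: "'a measure" and F :: "nat \<Rightarrow> 'a measure"
    and X :: "nat \<Rightarrow> nat \<Rightarrow> 'w \<Rightarrow> 'a"
    and T :: "nat \<Rightarrow> nat \<Rightarrow> (nat \<Rightarrow> 'a) \<Rightarrow> real"
    and h :: "nat \<Rightarrow> 'a \<Rightarrow> real"
    and n1 n2 :: "nat \<Rightarrow> nat" and lam :: "nat \<Rightarrow> real"
  assumes samples: "two_samples M S F X"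
    and statistic: "two_sample_statistic S T"
    and h_measurable: "\<And>i. i \<in> {1, 2} \<Longrightarrow> h i \<in> borel_measurable S"
    and h_moment: "\<And>i. i \<in> {1, 2} \<Longrightarrow> integrable (F i) (\<lambda>x. (h i x) ^ 4)"
    and L_centered: "\<And>m1 m2. 1 \<le> m1 \<Longrightarrow> 1 \<le> m2 \<Longrightarrow>
          prob_space.expectation M (\<lambda>\<omega>. linear_part h m1 m2 (pooled_sample X m1 m2 \<omega>)) = 0"
    and sizes: "filterlim (\<lambda>k. min (n1 k) (n2 k)) at_top sequentially"
    and ratio1: "(\<lambda>k. real (n1 k) / real (n1 k + n2 k)) \<longlonglongrightarrow> lam 1"
    and ratio2: "(\<lambda>k. real (n2 k) / real (n1 k + n2 k)) \<longlonglongrightarrow> lam 2"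
    and sigma_pos: "0 < asymptotic_variance M X h lam"
    and R_small: "(\<lambda>k. of_nat (n1 k + n2 k) *
          second_moment M (\<lambda>\<omega>. remainder T h (n1 k) (n2 k) (pooled_sample X (n1 k) (n2 k) \<omega>)))
        \<longlonglongrightarrow> 0"
    and R_diff1: "(\<lambda>k. of_nat ((n1 k + n2 k)\<^sup>2) *
          second_moment M (\<lambda>\<omega>. remainder T h (n1 k) (n2 k) (pooled_sample X (n1 k) (n2 k) \<omega>)
            - remainder_omit T h (n1 k) (n2 k) (pooled_sample X (n1 k) (n2 k) \<omega>) (n1 k)))
        \<longlonglongrightarrow> 0"
    and R_diff2: "(\<lambda>k. of_nat ((n1 k + n2 k)\<^sup>2) *
          second_moment M (\<lambda>\<omega>. remainder T h (n1 k) (n2 k) (pooled_sample X (n1 k) (n2 k) \<omega>)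
            - remainder_omit T h (n1 k) (n2 k) (pooled_sample X (n1 k) (n2 k) \<omega>) (n1 k + n2 k)))
        \<longlonglongrightarrow> 0"
  shows
    "(\<lambda>k. prob_space.variance M (\<lambda>\<omega>. sqrt (real (n1 k + n2 k)) *
          linear_part h (n1 k) (n2 k) (pooled_sample X (n1 k) (n2 k) \<omega>)))
        \<longlonglongrightarrow> asymptotic_variance M X h lam
    \<and> (\<forall>i :: nat \<Rightarrow> nat. (\<forall>\<^sub>F k in sequentially. i k \<in> {1..n1 k + n2 k}) \<longrightarrow>
      (\<lambda>k. second_moment M (\<lambda>\<omega>.
          pseudo_value T (n1 k) (n2 k) (pooled_sample X (n1 k) (n2 k) \<omega>) (i k)
            - xi h (n1 k) (pooled_sample X (n1 k) (n2 k) \<omega>) (i k)))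
        \<longlonglongrightarrow> 0)
    \<and> tendsto_in_probability M (\<lambda>k \<omega>.
        \<bar>sigma_sq_hat T (n1 k) (n2 k) (pooled_sample X (n1 k) (n2 k) \<omega>)
          / asymptotic_variance M X h lam - 1\<bar>) 0
    \<and> (\<forall>\<^sub>F k in sequentially.
        integrable M (\<lambda>\<omega>. sigma_sq_hat T (n1 k) (n2 k) (pooled_sample X (n1 k) (n2 k) \<omega>)))
    \<and> (\<lambda>k. \<bar>prob_space.expectation M
            (\<lambda>\<omega>. sigma_sq_hat T (n1 k) (n2 k) (pooled_sample X (n1 k) (n2 k) \<omega>))
          / asymptotic_variance M X h lam - 1\<bar>) \<longlonglongrightarrow> 0
    \<and> (\<forall>\<^sub>F k in sequentially.
        integrable M (\<lambda>\<omega>. (T (n1 k) (n2 k) (pooled_sample X (n1 k) (n2 k) \<omega>))\<^sup>2))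
    \<and> tendsto_in_probability M (\<lambda>k \<omega>.
        var_hat T (n1 k) (n2 k) (pooled_sample X (n1 k) (n2 k) \<omega>)
          / prob_space.variance M
              (\<lambda>\<omega>'. T (n1 k) (n2 k) (pooled_sample X (n1 k) (n2 k) \<omega>'))) 1
    \<and> (\<lambda>k. prob_space.expectation M
            (\<lambda>\<omega>. var_hat T (n1 k) (n2 k) (pooled_sample X (n1 k) (n2 k) \<omega>))
          / prob_space.variance M
              (\<lambda>\<omega>. T (n1 k) (n2 k) (pooled_sample X (n1 k) (n2 k) \<omega>))) \<longlonglongrightarrow> 1"
proof -
  interpret two_samples M S F X
    by (rule samples)
  \<comment> \<open>Centring of the linear part at the sample sizes (1, 1) and (2, 1) forces both score means to be 0.\<close>
  define E where "E i = (\<integral>x. h i x \<partial>F i)" for i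
  have h_int: "integrable M (\<lambda>\<omega>. h i (X i j \<omega>))" "expectation (\<lambda>\<omega>. h i (X i j \<omega>)) = E i"
    if "i \<in> {1, 2}" "1 \<le> j" for i j
    using fourth_moment_integrable[OF that(1) h_measurable[OF that(1)] h_moment[OF that(1)]]
      integrable_observation_iff[OF that h_measurable[OF that(1)]]
      expectation_observation[OF that h_measurable[OF that(1)]]
    by (simp_all add: E_def)
  have "E 1 + E 2 = 0"
    using L_centered[of 1 1] h_int
    by (simp add: linear_part_def pooled_sample_def numeral_2_eq_2)
  moreover have "2 * E 1 + E 2 = 0"
    using L_centered[of 2 1] h_int
    by (simp add: linear_part_def pooled_sample_def numeral_2_eq_2 numeral_3_eq_3)
  ultimately have "E i = 0" if "i \<in> {1, 2}" for i
    using that by auto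
  then interpret two_sample_scores M S F X h
    using h_measurable h_moment by unfold_locales (auto simp: E_def)

  define n where "n k = n1 k + n2 k" for k
  define Z where "Z k = pooled_sample X (n1 k) (n2 k)" for k
  define R where "R k \<omega> = remainder T h (n1 k) (n2 k) (Z k \<omega>)" for k \<omega>
  define \<Delta> where "\<Delta> k i \<omega> = R k \<omega> - remainder_omit T h (n1 k) (n2 k) (Z k \<omega>) i" for k i \<omega>
  define L where "L k \<omega> = linear_part h (n1 k) (n2 k) (Z k \<omega>)" for k \<omega>
  define D where "D k i \<omega> = pseudo_value T (n1 k) (n2 k) (Z k \<omega>) i - xi h (n1 k) (Z k \<omega>) i" for k i \<omega>
  define \<sigma> where "\<sigma> = asymptotic_variance M X h lam"
  have \<sigma>: "0 < \<sigma>"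
    using sigma_pos by (simp add: \<sigma>_def)
  have \<sigma>_eq: "\<sigma> = lam 1 * score_variance 1 + lam 2 * score_variance 2"
    using variance_observation[of 1] variance_observation[of 2]
    by (simp add: \<sigma>_def asymptotic_variance_def)

  have size1: "filterlim n1 at_top sequentially" and size2: "filterlim n2 at_top sequentially"
    using sizes by (auto intro: filterlim_at_top_mono)
  have big: "\<forall>\<^sub>F k in sequentially. 2 \<le> n1 k \<and> 2 \<le> n2 k"
    using sizes by (auto simp: filterlim_at_top)
  have R_meas: "\<forall>\<^sub>F k in sequentially. R k \<in> borel_measurable M"
    using big
  proof eventually_elim
    case (elim k)
    then show ?case
      unfolding R_def Z_def
      by (intro measurable_compose[OF measurable_pooled_sample] measurable_remainder h_measurable statistic)
        auto
  qed
  have \<Delta>_meas: "\<forall>\<^sub>F k in sequentially. \<Delta> k (i k) \<in> borel_measurable M" if "\<And>k. i k \<le> n k" for i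
    using R_meas big
  proof eventually_elim
    case (elim k)
    then show ?case
      unfolding \<Delta>_def Z_def using that[of k]
      by (intro borel_measurable_diff measurable_compose[OF measurable_pooled_sample]
          measurable_remainder_omit h_measurable statistic) (auto simp: n_def)
  qed
  have n_pos: "\<forall>\<^sub>F k in sequentially. 1 \<le> n k"
    using big by eventually_elim (simp add: n_def)
  then have n2_pos: "\<forall>\<^sub>F k in sequentially. 1 \<le> (n k)\<^sup>2"
    by eventually_elim simp
  note R_lim = scaled_second_moment_tendsto_zeroD
    [OF R_small[folded Z_def, folded n_def R_def] R_meas n_pos]
  note \<Delta>1_lim = scaled_second_moment_tendsto_zeroD
    [OF R_diff1[folded Z_def, folded n_def R_def, folded \<Delta>_def] \<Delta>_meas n2_pos]
  note \<Delta>2_lim = scaled_second_moment_tendsto_zeroD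
    [OF R_diff2[folded Z_def, folded n_def R_def, folded \<Delta>_def] \<Delta>_meas n2_pos]
  have \<Delta>1: "\<forall>\<^sub>F k in sequentially. integrable M (\<lambda>\<omega>. (\<Delta> k (n1 k) \<omega>)\<^sup>2)"
    "(\<lambda>k. real ((n k)\<^sup>2) * expectation (\<lambda>\<omega>. (\<Delta> k (n1 k) \<omega>)\<^sup>2)) \<longlonglongrightarrow> 0"
    by (rule \<Delta>1_lim; simp add: n_def)+
  have \<Delta>2: "\<forall>\<^sub>F k in sequentially. integrable M (\<lambda>\<omega>. (\<Delta> k (n k) \<omega>)\<^sup>2)"
    "(\<lambda>k. real ((n k)\<^sup>2) * expectation (\<lambda>\<omega>. (\<Delta> k (n k) \<omega>)\<^sup>2)) \<longlonglongrightarrow> 0"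
    by (rule \<Delta>2_lim; simp)+

  define \<delta> where "\<delta> k = 2 * (real ((n k)\<^sup>2) * expectation (\<lambda>\<omega>. (\<Delta> k (n1 k) \<omega>)\<^sup>2)
      + real ((n k)\<^sup>2) * expectation (\<lambda>\<omega>. (\<Delta> k (n k) \<omega>)\<^sup>2))
    + 2 * expectation (\<lambda>\<omega>. (R k \<omega>)\<^sup>2)" for k
  have ER: "(\<lambda>k. expectation (\<lambda>\<omega>. (R k \<omega>)\<^sup>2)) \<longlonglongrightarrow> 0"
  proof (rule tendsto_sandwich[OF _ _ tendsto_const R_lim(2)])
    show "\<forall>\<^sub>F k in sequentially. expectation (\<lambda>\<omega>. (R k \<omega>)\<^sup>2) \<le> real (n k) * expectation (\<lambda>\<omega>. (R k \<omega>)\<^sup>2)"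
      using n_pos
    proof eventually_elim
      case (elim k)
      then show ?case
        using mult_right_mono[of 1 "real (n k)" "expectation (\<lambda>\<omega>. (R k \<omega>)\<^sup>2)"] by simp
    qed
  qed simp
  have "\<delta> \<longlonglongrightarrow> 2 * (0 + 0) + 2 * 0"
    unfolding \<delta>_def[abs_def] by (intro tendsto_intros \<Delta>1(2) \<Delta>2(2) ER)
  then have \<delta>: "\<delta> \<longlonglongrightarrow> 0"
    by simp
  have D: "\<forall>\<^sub>F k in sequentially. \<forall>i\<in>{1..n k}. D k i \<in> borel_measurable M \<and>
      integrable M (\<lambda>\<omega>. (D k i \<omega>)\<^sup>2) \<and> expectation (\<lambda>\<omega>. (D k i \<omega>)\<^sup>2) \<le> \<delta> k"
    using big R_lim(1) \<Delta>1(1) \<Delta>2(1)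
  proof eventually_elim
    case (elim k)
    then have sizes_k: "2 \<le> n1 k" "2 \<le> n2 k"
      by simp_all
    show ?case
    proof (intro ballI)
      fix i
      assume "i \<in> {1..n k}"
      then have i: "i \<in> {1..n1 k + n2 k}"
        by (simp add: n_def)
      note bound = score_error_bound[OF statistic sizes_k i, folded Z_def, folded R_def,
          folded \<Delta>_def D_def n_def, OF elim(2-4)]
      show "D k i \<in> borel_measurable M \<and> integrable M (\<lambda>\<omega>. (D k i \<omega>)\<^sup>2) \<and>
          expectation (\<lambda>\<omega>. (D k i \<omega>)\<^sup>2) \<le> \<delta> k"
        unfolding \<delta>_def by (intro conjI bound)
    qed
  qed

  define \<tau> where "\<tau> J k \<omega> = sample_variance (J k) (pseudo_value T (n1 k) (n2 k) (Z k \<omega>))"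
    for J :: "nat \<Rightarrow> nat set" and k \<omega>
  have \<tau>: "\<forall>\<^sub>F k in sequentially. integrable M (\<tau> J k)"
    "(\<lambda>k. expectation (\<lambda>\<omega>. \<bar>\<tau> J k \<omega> - score_variance i\<bar>)) \<longlonglongrightarrow> 0"
    if J: "\<And>k. J k \<subseteq> {1..n k}" "\<And>k j. j \<in> J k \<Longrightarrow> sample_of (n1 k) j = i"
      and size: "filterlim (\<lambda>k. card (J k)) at_top sequentially" for J i
  proof -
    have eq: "\<tau> J k \<omega> = sample_variance (J k) (\<lambda>j. score (n1 k) (n2 k) j \<omega> + D k j \<omega>)" for k \<omega>
      by (simp add: \<tau>_def score_def D_def Z_def)
    have "\<forall>\<^sub>F k in sequentially. \<forall>j\<in>J k. D k j \<in> borel_measurable M \<and>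
        integrable M (\<lambda>\<omega>. (D k j \<omega>)\<^sup>2) \<and> expectation (\<lambda>\<omega>. (D k j \<omega>)\<^sup>2) \<le> \<delta> k"
      using D by eventually_elim (use J(1) in blast)
    from block_sample_variance_tendsto[OF J(1)[unfolded n_def] J(2) size this \<delta>]
    show "\<forall>\<^sub>F k in sequentially. integrable M (\<tau> J k)"
      "(\<lambda>k. expectation (\<lambda>\<omega>. \<bar>\<tau> J k \<omega> - score_variance i\<bar>)) \<longlonglongrightarrow> 0"
      by (simp_all add: eq[abs_def])
  qed
  define t1 where "t1 k \<omega> = tau1_sq_hat T (n1 k) (n2 k) (Z k \<omega>)" for k \<omega>
  define t2 where "t2 k \<omega> = tau2_sq_hat T (n1 k) (n2 k) (Z k \<omega>)" for k \<omega>
  have t1: "\<forall>\<^sub>F k in sequentially. integrable M (t1 k)"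
    "(\<lambda>k. expectation (\<lambda>\<omega>. \<bar>t1 k \<omega> - score_variance 1\<bar>)) \<longlonglongrightarrow> 0"
    using \<tau>[of "\<lambda>k. {1..n1 k}" 1] size1
    by (simp_all add: t1_def[abs_def] tau1_sq_hat_eq \<tau>_def[abs_def] n_def sample_of_def subset_iff)
  have t2: "\<forall>\<^sub>F k in sequentially. integrable M (t2 k)"
    "(\<lambda>k. expectation (\<lambda>\<omega>. \<bar>t2 k \<omega> - score_variance 2\<bar>)) \<longlonglongrightarrow> 0"
    using \<tau>[of "\<lambda>k. {n1 k + 1..n1 k + n2 k}" 2] size2
    by (simp_all add: t2_def[abs_def] tau2_sq_hat_eq \<tau>_def[abs_def] n_def sample_of_def subset_iff)

  define q1 where "q1 k = real (n1 k) / real (n k)" for k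
  define q2 where "q2 k = real (n2 k) / real (n k)" for k
  have q: "q1 \<longlonglongrightarrow> lam 1" "q2 \<longlonglongrightarrow> lam 2" "\<And>k. 0 \<le> q1 k" "\<And>k. 0 \<le> q2 k"
    using ratio1 ratio2 by (simp_all add: q1_def[abs_def] q2_def[abs_def] n_def)
  define \<sigma>n where "\<sigma>n k = q1 k * score_variance 1 + q2 k * score_variance 2" for k
  have \<sigma>n: "\<sigma>n \<longlonglongrightarrow> \<sigma>"
    unfolding \<sigma>n_def[abs_def] \<sigma>_eq by (intro tendsto_intros q)
  define s where "s k \<omega> = sigma_sq_hat T (n1 k) (n2 k) (Z k \<omega>)" for k \<omega>
  have s_eq: "s k \<omega> = q1 k * t1 k \<omega> + q2 k * t2 k \<omega>" for k \<omega>
    by (simp add: s_def sigma_sq_hat_def t1_def t2_def q1_def q2_def n_def)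
  have s_int: "\<forall>\<^sub>F k in sequentially. integrable M (s k)"
    using t1(1) t2(1) by eventually_elim (simp add: s_eq[abs_def])
  \<comment> \<open>The weights converge but may tend to 0, so \<open>s - \<sigma>\<close> is split into weighted errors of the two
    sample variances and the error of the weights.\<close>
  have s_L1: "(\<lambda>k. expectation (\<lambda>\<omega>. \<bar>s k \<omega> - \<sigma>\<bar>)) \<longlonglongrightarrow> 0"
  proof (rule tendsto_sandwich[OF _ _ tendsto_const])
    let ?bound = "\<lambda>k. q1 k * expectation (\<lambda>\<omega>. \<bar>t1 k \<omega> - score_variance 1\<bar>)
      + q2 k * expectation (\<lambda>\<omega>. \<bar>t2 k \<omega> - score_variance 2\<bar>) + \<bar>\<sigma>n k - \<sigma>\<bar>"
    have "?bound \<longlonglongrightarrow> lam 1 * 0 + lam 2 * 0 + \<bar>\<sigma> - \<sigma>\<bar>"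
      by (intro tendsto_intros q t1(2) t2(2) \<sigma>n)
    then show "?bound \<longlonglongrightarrow> 0"
      by simp
    show "\<forall>\<^sub>F k in sequentially. expectation (\<lambda>\<omega>. \<bar>s k \<omega> - \<sigma>\<bar>) \<le> ?bound k"
      using t1(1) t2(1) s_int
    proof eventually_elim
      case (elim k)
      have "expectation (\<lambda>\<omega>. \<bar>s k \<omega> - \<sigma>\<bar>) \<le> expectation (\<lambda>\<omega>. q1 k * \<bar>t1 k \<omega> - score_variance 1\<bar>
          + q2 k * \<bar>t2 k \<omega> - score_variance 2\<bar> + \<bar>\<sigma>n k - \<sigma>\<bar>)"
      proof (rule integral_mono)
        fix \<omega>
        have "s k \<omega> - \<sigma> = q1 k * (t1 k \<omega> - score_variance 1) + q2 k * (t2 k \<omega> - score_variance 2) + (\<sigma>n k - \<sigma>)"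
          by (simp add: s_eq \<sigma>n_def algebra_simps)
        also have "\<bar>\<dots>\<bar> \<le> \<bar>q1 k * (t1 k \<omega> - score_variance 1)\<bar> + \<bar>q2 k * (t2 k \<omega> - score_variance 2)\<bar> + \<bar>\<sigma>n k - \<sigma>\<bar>"
          by linarith
        finally show "\<bar>s k \<omega> - \<sigma>\<bar> \<le> q1 k * \<bar>t1 k \<omega> - score_variance 1\<bar>
          + q2 k * \<bar>t2 k \<omega> - score_variance 2\<bar> + \<bar>\<sigma>n k - \<sigma>\<bar>"
          using q(3,4) by (simp add: abs_mult)
      qed (use elim in auto)
      also have "\<dots> = ?bound k"
        using elim by (simp add: prob_space)
      finally show ?case .
    qed
  qed simp

  have L: "\<forall>\<^sub>F k in sequentially. L k \<in> borel_measurable M \<and> integrable M (\<lambda>\<omega>. (L k \<omega>)\<^sup>2) \<and>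
      expectation (L k) = 0 \<and> real (n k) * expectation (\<lambda>\<omega>. (L k \<omega>)\<^sup>2) = \<sigma>n k"
    using big
  proof eventually_elim
    case (elim k)
    then show ?case
      using linear_part_moments[of "n1 k" "n2 k"]
      unfolding L_def[abs_def] Z_def \<sigma>n_def q1_def q2_def n_def by auto
  qed
  define w where "w k = real (n k) * variance (\<lambda>\<omega>. T (n1 k) (n2 k) (Z k \<omega>))" for k
  have T_eq: "T (n1 k) (n2 k) (Z k \<omega>) = L k \<omega> + R k \<omega>" for k \<omega>
    by (simp add: L_def R_def remainder_def)
  have T_int: "\<forall>\<^sub>F k in sequentially. integrable M (\<lambda>\<omega>. (T (n1 k) (n2 k) (Z k \<omega>))\<^sup>2)"
    using L R_meas R_lim(1) unfolding T_eq
    by eventually_elim (auto intro: integrable_square_add)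
  \<comment> \<open>\<open>\<sigma>n k\<close> is \<open>n Var(L\<^sub>n)\<close>, from which \<open>n Var(T\<^sub>n)\<close> differs by a perturbation of order
    \<open>n E(R\<^sub>n\<^sup>2)\<close>.\<close>
  have "(\<lambda>k. w k - \<sigma>n k) \<longlonglongrightarrow> 0"
  proof (rule tendsto_zero_of_perturbation_bound[OF _ \<sigma>n R_lim(2)])
    fix e :: real
    assume e: "0 < e"
    show "\<forall>\<^sub>F k in sequentially. \<bar>w k - \<sigma>n k\<bar>
        \<le> e * \<sigma>n k + (1 + 1 / e) * (real (n k) * expectation (\<lambda>\<omega>. (R k \<omega>)\<^sup>2))"
      using L R_meas R_lim(1)
    proof eventually_elim
      case (elim k)
      let ?l = "expectation (\<lambda>\<omega>. (L k \<omega>)\<^sup>2)" and ?r = "expectation (\<lambda>\<omega>. (R k \<omega>)\<^sup>2)"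
      have "\<bar>w k - \<sigma>n k\<bar> = real (n k) * \<bar>variance (\<lambda>\<omega>. L k \<omega> + R k \<omega>) - ?l\<bar>"
      proof -
        have \<sigma>n_k: "\<sigma>n k = real (n k) * ?l"
          using elim(1) by simp
        show ?thesis
          unfolding w_def T_eq \<sigma>n_k right_diff_distrib[symmetric] abs_mult by simp
      qed
      also have "\<dots> \<le> real (n k) * (e * ?l + (1 + 1 / e) * ?r)"
        using elim e by (intro mult_left_mono variance_perturbation) auto
      also have "\<dots> = e * (real (n k) * ?l) + (1 + 1 / e) * (real (n k) * ?r)"
        by (simp add: algebra_simps)
      finally show ?case
        using elim(1) by simp
    qed
  qed
  from tendsto_add[OF this \<sigma>n] have w: "w \<longlonglongrightarrow> \<sigma>"
    by simp

  have var_L: "(\<lambda>k. variance (\<lambda>\<omega>. sqrt (real (n k)) * L k \<omega>)) \<longlonglongrightarrow> \<sigma>"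
  proof (rule Lim_transform_eventually[OF \<sigma>n])
    show "\<forall>\<^sub>F k in sequentially. \<sigma>n k = variance (\<lambda>\<omega>. sqrt (real (n k)) * L k \<omega>)"
      using L by eventually_elim (simp add: power_mult_distrib)
  qed
  have pseudo: "(\<lambda>k. second_moment M (D k (i k))) \<longlonglongrightarrow> 0"
    if i: "\<forall>\<^sub>F k in sequentially. i k \<in> {1..n k}" for i
  proof (rule tendsto_sandwich[OF _ _ tendsto_const])
    show "(\<lambda>k. ennreal (\<delta> k)) \<longlonglongrightarrow> 0"
      using tendsto_ennrealI[OF \<delta>] by simp
    show "\<forall>\<^sub>F k in sequentially. second_moment M (D k (i k)) \<le> ennreal (\<delta> k)"
      using i D by eventually_elim (auto simp: second_moment_eq_expectation intro!: ennreal_leI)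
  qed simp

  note s_ratio = ratio_L1_tendsto[OF s_int s_L1 tendsto_const \<sigma>]
  note v_ratio = ratio_L1_tendsto[OF s_int s_L1 w \<sigma>]
  have s_ratio_int: "\<forall>\<^sub>F k in sequentially. integrable M (\<lambda>\<omega>. s k \<omega> / c k)" for c
    using s_int by eventually_elim simp
  have v_eq: "var_hat T (n1 k) (n2 k) (Z k \<omega>) / variance (\<lambda>\<omega>'. T (n1 k) (n2 k) (Z k \<omega>')) = s k \<omega> / w k"
    for k \<omega>
    by (simp add: var_hat_def s_def w_def n_def)
  have s_prob: "tendsto_in_probability M (\<lambda>k \<omega>. \<bar>s k \<omega> / \<sigma> - 1\<bar>) 0"
    using s_ratio s_int by (intro tendsto_in_probability_if_L1) (auto elim!: eventually_mono)
  have s_bias: "(\<lambda>k. \<bar>expectation (s k) / \<sigma> - 1\<bar>) \<longlonglongrightarrow> 0"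
  proof -
    have "(\<lambda>k. expectation (\<lambda>\<omega>. s k \<omega> / \<sigma>)) \<longlonglongrightarrow> 1"
      by (rule expectation_tendsto_if_L1[OF s_ratio_int s_ratio])
    then show ?thesis
      by (simp add: tendsto_rabs_zero_iff LIM_zero)
  qed
  have v_prob: "tendsto_in_probability M (\<lambda>k \<omega>. var_hat T (n1 k) (n2 k) (Z k \<omega>)
      / variance (\<lambda>\<omega>'. T (n1 k) (n2 k) (Z k \<omega>'))) 1"
    unfolding v_eq by (rule tendsto_in_probability_if_L1[OF s_ratio_int v_ratio])
  have v_bias: "(\<lambda>k. expectation (\<lambda>\<omega>. var_hat T (n1 k) (n2 k) (Z k \<omega>))
      / variance (\<lambda>\<omega>. T (n1 k) (n2 k) (Z k \<omega>))) \<longlonglongrightarrow> 1"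
  proof -
    have "(\<lambda>k. expectation (\<lambda>\<omega>. s k \<omega> / w k)) \<longlonglongrightarrow> 1"
      by (rule expectation_tendsto_if_L1[OF s_ratio_int v_ratio])
    then show ?thesis
      by (simp add: var_hat_def s_def w_def n_def)
  qed
  show ?thesis
    using var_L pseudo s_prob s_int s_bias T_int v_prob v_bias
    unfolding s_def[abs_def] D_def[abs_def] L_def[abs_def] n_def Z_def \<sigma>_def
    by blast
qed

end
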